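(* Let $\rho_1,\rho_2\in\mathcal P(\mathbb R^3)$ be such that $$\mu_{\rho_i}(\beta)<\frac{1}{N(N-1)^2}\qquad\text{for }i=1,2,$$ for a suitable $\beta>0$. Then for every $\alpha>0$ with $\alpha<\phi^{-1}\big(\frac{N^2(N-1)}{2}\phi(\beta)\big)$ we have $$|C(\rho_1)-C(\rho_2)|\le N^2(N-1)^2\,\phi\Big(\frac{\alpha}{2}\Big)\,\|\rho_1-\rho_2\|_{L^1}.$$
   Context: $N>1$ is an integer and $d=3$; $\mathcal P(X)$ is the set of Borel probability measures on $X$. The function $\phi:(0,+\infty)\to[0,+\infty)$ is continuous, strictly decreasing, and $\lim_{t\to0^+}\phi(t)=+\infty$; by convention $\phi(0)=+\infty$. The cost is $c(x_1,\dots,x_N)=\sum_{1\le i<j\le N}\phi(|x_i-x_j|)$ for $x_1,\dots,x_N\in\mathbb R^d$. $\Pi(\rho)$ is the set of $P\in\mathcal P(\mathbb R^{Nd})$ all of whose $N$ marginals on the factors $\mathbb R^d$ are equal to $\rho$, and $C(\rho)=\min_{P\in\Pi(\rho)}\int c\,dP$. Measure of concentration: $\mu_\rho(r)=\sup_{x\in\mathbb R^d}\rho(B(x,r))$, with $B(x,r)$ the open ball. $\|\rho_1-\rho_2\|_{L^1}$ denotes the total mass $|\rho_1-\rho_2|(\mathbb R^3)$ of the total variation measure of the signed measure $\rho_1-\rho_2$; when both measures have densities this is the $L^1$ norm of the difference of the densities. *)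

theory Defs
  imports "HOL-Probability.Probability"
begin

type_synonym R3 = "real ^ 3"

text \<open>The convention \<open>\<phi>(0) = +\<infinity>\<close>; only arguments \<open>t \<ge> 0\<close> matter.\<close>

definition phi_ext :: "(real \<Rightarrow> real) \<Rightarrow> real \<Rightarrow> ennreal" where
  "phi_ext \<phi> t = (if t = 0 then \<infinity> else ennreal (\<phi> t))"

text \<open>A point \<open>(x\<^sub>1, \<dots>, x\<^sub>N)\<close> of \<open>\<real>\<^sup>3\<^sup>N\<close> is a function on the index set \<open>{..<N}\<close>.\<close>

definition cost :: "(real \<Rightarrow> real) \<Rightarrow> nat \<Rightarrow> (nat \<Rightarrow> R3) \<Rightarrow> ennreal" where
  "cost \<phi> N x = (\<Sum>j<N. \<Sum>i<j. phi_ext \<phi> (norm (x i - x j)))"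

definition borel_prob :: "R3 measure \<Rightarrow> bool" where
  "borel_prob \<rho> \<longleftrightarrow> prob_space \<rho> \<and> sets \<rho> = sets borel"

text \<open>The finite product sigma algebra is the Borel sigma algebra of \<open>\<real>\<^sup>3\<^sup>N\<close>, as \<open>\<real>\<^sup>3\<close> is
  second countable.\<close>

definition transport_plans :: "nat \<Rightarrow> R3 measure \<Rightarrow> (nat \<Rightarrow> R3) measure set" where
  "transport_plans N \<rho> =
     {P. prob_space P \<and> sets P = sets (PiM {..<N} (\<lambda>_. borel)) \<and>
         (\<forall>i<N. distr P borel (\<lambda>x. x i) = \<rho>)}"

text \<open>The minimal transport cost, written as an infimum in \<open>[0, \<infinity>]\<close> so that the value is defined
  without presupposing that the minimum is attained.\<close>

definition opt_cost :: "(real \<Rightarrow> real) \<Rightarrow> nat \<Rightarrow> R3 measure \<Rightarrow> ennreal" where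
  "opt_cost \<phi> N \<rho> = (INF P\<in>transport_plans N \<rho>. \<integral>\<^sup>+ x. cost \<phi> N x \<partial>P)"

definition concentration :: "R3 measure \<Rightarrow> real \<Rightarrow> real" where
  "concentration \<rho> r = (SUP x. measure \<rho> (ball x r))"

text \<open>The total variation measure \<open>|\<rho>\<^sub>1 - \<rho>\<^sub>2|(E)\<close> of the signed measure \<open>\<rho>\<^sub>1 - \<rho>\<^sub>2\<close>: the supremum
  over countable Borel partitions of \<open>E\<close>. The real differences are meaningful for finite measures only.\<close>

definition total_variation :: "R3 measure \<Rightarrow> R3 measure \<Rightarrow> R3 set \<Rightarrow> ennreal" where
  "total_variation \<rho>\<^sub>1 \<rho>\<^sub>2 E =
     (SUP A\<in>{A :: nat \<Rightarrow> R3 set. range A \<subseteq> sets borel \<and> disjoint_family A \<and> (\<Union>n. A n) = E}.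
        \<Sum>n. ennreal \<bar>measure \<rho>\<^sub>1 (A n) - measure \<rho>\<^sub>2 (A n)\<bar>)"

definition L1_dist :: "R3 measure \<Rightarrow> R3 measure \<Rightarrow> ennreal" where
  "L1_dist \<rho>\<^sub>1 \<rho>\<^sub>2 = total_variation \<rho>\<^sub>1 \<rho>\<^sub>2 UNIV"

end

theory Submission
  imports Defs
begin

text \<open>
  The argument is purely primal. Given a plan \<open>P\<close> and a small measure \<open>R\<close> of possibly bad
  configurations \<open>x\<close> (points close together, infinite cost), sample \<open>y\<^sub>1, \<dots>, y\<^sub>N\<^sub>-\<^sub>1\<close> independently
  from \<open>P\<close>, conditioned on the relevant points being \<open>\<beta>\<close>-separated, and exchange the \<open>j\<close>-th points
  of \<open>x\<close> and \<open>y\<^sub>j\<close>. All marginals are preserved, every configuration that arises costs at most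
  \<open>N\<^sup>2 \<phi>(\<beta>)\<close> more than the one it replaces, and at most \<open>2(N-1)\<^sup>2\<close> closeness events have to be
  avoided, so the concentration bound gives the conditioning probability at least \<open>l > 0\<close>.

  Applied with cost \<open>1\<close> for each pair closer than \<open>\<beta>\<close>, the exchange shrinks the bad mass of a plan
  by the factor \<open>1 - l/N\<close>; once this mass is small, a last exchange with the good part produces a
  plan of finite cost. For the estimate, let \<open>m\<close> be half of the \<open>L\<^sup>1\<close> distance. From a plan \<open>P\<^sub>0\<close> for
  \<open>\<rho>\<^sub>0\<close> keep all but a mass \<open>N m\<close>, so that the kept part has marginals below \<open>\<rho>\<^sub>1\<close>, and complete it
  by an arbitrary coupling \<open>R\<close>. Mixing this with weight \<open>e = l/N\<close> into a nearly optimal plan for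
  \<open>\<rho>\<^sub>1\<close> and exchanging away \<open>R\<close> gives \<open>C(\<rho>\<^sub>1) \<le> (1 - e) C(\<rho>\<^sub>1) + e (C(\<rho>\<^sub>0) + N\<^sup>4 \<phi>(\<beta>) m)\<close>, and \<open>e\<close>
  cancels. Finally \<open>\<phi>(\<alpha>/2) \<ge> N\<^sup>2 (N-1)/2 \<phi>(\<beta>)\<close> by the choice of \<open>\<alpha>\<close>.
\<close>

section \<open>Sums and differences of measures\<close>

text \<open>Marginals and costs of plans are both integrals, so a sum of measures is specified by
  its effect on every nonnegative measurable function. The formula holds for indicators by
  construction and extends by induction over measurable functions.\<close>

lemma ex_measure_add:
  assumes "sets M = sets S" "sets N = sets S"
  obtains T where "sets T = sets S"
    and "\<And>f. f \<in> borel_measurable S \<Longrightarrow> (\<integral>\<^sup>+x. f x \<partial>T) = (\<integral>\<^sup>+x. f x \<partial>M) + (\<integral>\<^sup>+x. f x \<partial>N)"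
proof -
  define T where "T = measure_of (space S) (sets S) (\<lambda>A. emeasure M A + emeasure N A)"
  have s[simp]: "sets T = sets S" "space T = space S" by (auto simp: T_def)
  note [measurable_cong] = assms s(1)
  have e: "emeasure T A = emeasure M A + emeasure N A" if "A \<in> sets S" for A
    unfolding T_def
  proof (rule emeasure_measure_of_sigma)
    show "sigma_algebra (space S) (sets S)" by (rule sets.sigma_algebra_axioms)
    show "positive (sets S) (\<lambda>A. emeasure M A + emeasure N A)" by (simp add: positive_def)
    show "countably_additive (sets S) (\<lambda>A. emeasure M A + emeasure N A)"
      unfolding countably_additive_def
      using assms by (auto simp: suminf_add[symmetric] suminf_emeasure)
  qed fact
  have "(\<integral>\<^sup>+x. f x \<partial>T) = (\<integral>\<^sup>+x. f x \<partial>M) + (\<integral>\<^sup>+x. f x \<partial>N)" if "f \<in> borel_measurable S" for f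
    using that
  proof (induction rule: borel_measurable_induct)
    case (cong f g)
    then show ?case
      using sets_eq_imp_space_eq[OF assms(1)] sets_eq_imp_space_eq[OF assms(2)]
        nn_integral_cong[of T f g] nn_integral_cong[of M f g] nn_integral_cong[of N f g]
      by simp
  next
    case (set A)
    then show ?case using assms by (simp add: e)
  next
    case (mult u c)
    then show ?case by (simp add: nn_integral_cmult distrib_left)
  next
    case (add u v)
    then show ?case by (simp add: nn_integral_add ac_simps)
  next
    case (seq U)
    then show ?case
      by (auto simp: nn_integral_monotone_convergence_SUP incseq_nn_integral
          ennreal_SUP_add[symmetric] image_comp)
  qed
  with s show ?thesis by (intro that[of T]) auto
qed

lemma ex_measure_sum:
  assumes "finite I" "\<And>i. i \<in> I \<Longrightarrow> sets (M i) = sets S"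
  obtains T where "sets T = sets S"
    and "\<And>f. f \<in> borel_measurable S \<Longrightarrow> (\<integral>\<^sup>+x. f x \<partial>T) = (\<Sum>i\<in>I. \<integral>\<^sup>+x. f x \<partial>M i)"
  using assms
proof (induction I arbitrary: thesis rule: finite_induct)
  case empty
  show ?case by (rule empty(1)[of "null_measure S"]) auto
next
  case (insert i I)
  obtain T where T: "sets T = sets S"
    "\<And>f. f \<in> borel_measurable S \<Longrightarrow> (\<integral>\<^sup>+x. f x \<partial>T) = (\<Sum>i\<in>I. \<integral>\<^sup>+x. f x \<partial>M i)"
    using insert.IH insert.prems(2) by auto
  obtain T' where T': "sets T' = sets S"
    "\<And>f. f \<in> borel_measurable S \<Longrightarrow> (\<integral>\<^sup>+x. f x \<partial>T') = (\<integral>\<^sup>+x. f x \<partial>M i) + (\<integral>\<^sup>+x. f x \<partial>T)"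
    using ex_measure_add[of "M i" S T] insert.prems(2) T(1) by auto
  show ?case
    by (rule insert.prems(1)[OF T'(1)]) (simp add: T'(2) T(2) insert.hyps)
qed

text \<open>Subtraction in \<open>ennreal\<close> is truncated; domination of \<open>N\<close> by
  \<open>M\<close> makes it exact. The integral formula then comes from the sum case, once
  \<open>D\<close> plus \<open>N\<close> is identified with \<open>M\<close> on measurable
  sets.\<close>

lemma ex_measure_diff:
  assumes "finite_measure M" "sets M = sets S" "sets N = sets S"
    and "\<And>A. A \<in> sets S \<Longrightarrow> emeasure N A \<le> emeasure M A"
  obtains D where "sets D = sets S"
    and "\<And>f. f \<in> borel_measurable S \<Longrightarrow> (\<integral>\<^sup>+x. f x \<partial>M) = (\<integral>\<^sup>+x. f x \<partial>D) + (\<integral>\<^sup>+x. f x \<partial>N)"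
proof -
  interpret M: finite_measure M by fact
  have fN: "finite_measure N"
    using assms(4)[OF sets.top] sets_eq_imp_space_eq[OF assms(2)] sets_eq_imp_space_eq[OF assms(3)]
      M.emeasure_finite[of "space M"]
    by (intro finite_measureI) (auto simp: top_unique)
  let ?D = "diff_measure M N"
  obtain T where T: "sets T = sets S"
    "\<And>f. f \<in> borel_measurable S \<Longrightarrow> (\<integral>\<^sup>+x. f x \<partial>T) = (\<integral>\<^sup>+x. f x \<partial>?D) + (\<integral>\<^sup>+x. f x \<partial>N)"
    using ex_measure_add[of ?D S N] assms by auto
  have "T = M"
  proof (rule measure_eqI)
    fix A assume "A \<in> sets T"
    then have A: "A \<in> sets S" using T by simp
    have "emeasure T A = emeasure ?D A + emeasure N A"
      using T(2)[of "indicator A"] A T(1) assms by simp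
    also have "emeasure ?D A = emeasure M A - emeasure N A"
      using A assms fN by (intro emeasure_diff_measure) (auto simp: M.finite_measure_axioms)
    finally show "emeasure T A = emeasure M A"
      using assms(4)[OF A] by (simp add: diff_add_cancel_ennreal)
  qed (use T assms in simp)
  with T show ?thesis using assms by (intro that[of ?D]) auto
qed

section \<open>Pair interaction sums of configurations\<close>

text \<open>The interaction is a parameter because two of them occur: the one that gives
  \<open>cost\<close>, and \<open>indicator {..<\<beta>}\<close>, which counts the close
  pairs.\<close>

definition pairsum :: "(real \<Rightarrow> ennreal) \<Rightarrow> nat \<Rightarrow> (nat \<Rightarrow> R3) \<Rightarrow> ennreal" where
  "pairsum \<psi> N x = (\<Sum>j<N. \<Sum>i<j. \<psi> (norm (x i - x j)))"

abbreviation config :: "nat \<Rightarrow> (nat \<Rightarrow> R3) measure" where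
  "config N \<equiv> PiM {..<N} (\<lambda>_. borel)"

lemma pairsum_measurable[measurable]:
  assumes [measurable]: "\<psi> \<in> borel_measurable borel"
  shows "pairsum \<psi> N \<in> borel_measurable (config N)"
  unfolding pairsum_def
  by (intro borel_measurable_sum) (auto intro!: measurable_compose[OF _ assms])

text \<open>Counting all \<open>N ^ 2\<close> ordered pairs is wasteful, but the final constant
  leaves room for it.\<close>

lemma pairsum_le:
  assumes "\<And>i j. i < j \<Longrightarrow> j < N \<Longrightarrow> \<psi> (norm (x i - x j)) \<le> \<psi> (norm (y i - y j)) + (A :: ennreal)"
  shows "pairsum \<psi> N x \<le> pairsum \<psi> N y + of_nat N ^ 2 * A"
proof -
  have "pairsum \<psi> N x \<le> (\<Sum>j<N. \<Sum>i<j. \<psi> (norm (y i - y j)) + A)"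
    unfolding pairsum_def by (intro sum_mono assms) auto
  also have "\<dots> = pairsum \<psi> N y + (\<Sum>j<N. \<Sum>i<j. A)"
    by (simp add: pairsum_def sum.distrib)
  also have "(\<Sum>j<N. \<Sum>i<j. A) \<le> (\<Sum>j<N. \<Sum>i<N. A)"
    by (intro sum_mono sum_mono2) auto
  also have "\<dots> = of_nat N ^ 2 * A"
    by (simp add: power2_eq_square mult.assoc)
  finally show ?thesis by (simp add: add_left_mono)
qed

lemma pairsum_le_const:
  assumes "\<And>i j. i < j \<Longrightarrow> j < N \<Longrightarrow> \<psi> (norm (x i - x j)) \<le> (A :: ennreal)"
  shows "pairsum \<psi> N x \<le> of_nat N ^ 2 * A"
proof -
  have "pairsum \<psi> N x \<le> (\<Sum>j<N. \<Sum>i<j. A)"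
    unfolding pairsum_def by (intro sum_mono assms) auto
  also have "(\<Sum>j<N. \<Sum>i<j. A) \<le> (\<Sum>j<N. \<Sum>i<N. A)"
    by (intro sum_mono sum_mono2) auto
  also have "\<dots> = of_nat N ^ 2 * A"
    by (simp add: power2_eq_square mult.assoc)
  finally show ?thesis .
qed

section \<open>Sampling separated configurations\<close>

text \<open>By Fubini the sample \<open>y j\<close> can be integrated first. The centre
  \<open>c y\<close> does not depend on it, hence is frozen in the inner integral, and the
  concentration bound applies there uniformly in the other samples.\<close>

lemma prob_close_le:
  assumes P: "prob_space P" "sets P = sets (config N)"
    and conc: "\<And>z. emeasure P {x\<in>space P. dist z (x i) < \<beta>} \<le> \<kappa>"
    and J: "finite J" "j \<in> J" "i < N"
    and c[measurable]: "c \<in> borel_measurable (PiM J (\<lambda>_. P))"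
    and c_upd: "\<And>y z. c (y(j := z)) = c y"
  shows "emeasure (PiM J (\<lambda>_. P)) {y\<in>space (PiM J (\<lambda>_. P)). dist (c y) (y j i) < \<beta>} \<le> \<kappa>"
proof -
  interpret P: prob_space P by fact
  interpret PP: product_sigma_finite "\<lambda>_. P"
    by (simp add: product_sigma_finite_def P.sigma_finite_measure_axioms)
  interpret Q: prob_space "PiM (J - {j}) (\<lambda>_. P)" by (rule prob_space_PiM) (rule P)
  note [measurable_cong] = P(2)
  have [measurable]: "(\<lambda>y. y j i) \<in> borel_measurable (PiM J (\<lambda>_. P))"
    using J by (intro measurable_compose[OF measurable_component_singleton[of j J "\<lambda>_. P"]])
      (simp_all add: measurable_cong_sets[OF P(2) refl])
  let ?f = "\<lambda>y. indicator {y. dist (c y) (y j i) < \<beta>} y :: ennreal"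
  have f: "?f \<in> borel_measurable (PiM J (\<lambda>_. P))" by measurable
  have ins: "insert j (J - {j}) = J" using J by auto
  have "emeasure (PiM J (\<lambda>_. P)) {y\<in>space (PiM J (\<lambda>_. P)). dist (c y) (y j i) < \<beta>}
      = (\<integral>\<^sup>+y. indicator {y\<in>space (PiM J (\<lambda>_. P)). dist (c y) (y j i) < \<beta>} y \<partial>PiM J (\<lambda>_. P))"
    by simp
  also have "\<dots> = (\<integral>\<^sup>+y. ?f y \<partial>PiM (insert j (J - {j})) (\<lambda>_. P))"
    unfolding ins by (intro nn_integral_cong) (auto simp: indicator_def)
  also have "\<dots> = (\<integral>\<^sup>+y. (\<integral>\<^sup>+z. ?f (y(j := z)) \<partial>P) \<partial>PiM (J - {j}) (\<lambda>_. P))"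
    using J f by (intro PP.product_nn_integral_insert) (simp_all only: ins, auto)
  also have "\<dots> \<le> (\<integral>\<^sup>+y. \<kappa> \<partial>PiM (J - {j}) (\<lambda>_. P))"
  proof (intro nn_integral_mono)
    fix y
    have [measurable]: "(\<lambda>z. z i) \<in> borel_measurable P"
      using J by (simp add: measurable_cong_sets[OF P(2) refl])
    have "(\<integral>\<^sup>+z. ?f (y(j := z)) \<partial>P) = (\<integral>\<^sup>+z. indicator {z\<in>space P. dist (c y) (z i) < \<beta>} z \<partial>P)"
      by (intro nn_integral_cong) (auto simp: indicator_def c_upd)
    also have "\<dots> = emeasure P {z\<in>space P. dist (c y) (z i) < \<beta>}" by simp
    also have "\<dots> \<le> \<kappa>" by (rule conc)
    finally show "(\<integral>\<^sup>+z. ?f (y(j := z)) \<partial>P) \<le> \<kappa>" .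
  qed
  also have "\<dots> = \<kappa>" by (simp add: Q.emeasure_space_1)
  finally show ?thesis .
qed

text \<open>
  The configuration \<open>pivot x y\<close> collects the points given away: \<open>x\<^sub>0\<close> stays, and \<open>y\<^sub>k\<close> gives its
  \<open>k\<close>-th point in return for \<open>x\<^sub>k\<close>. Being \<open>separated\<close> means that the exchange creates no new close pair.
\<close>

definition pivot :: "(nat \<Rightarrow> R3) \<Rightarrow> (nat \<Rightarrow> nat \<Rightarrow> R3) \<Rightarrow> nat \<Rightarrow> R3" where
  "pivot x y k = (if k = 0 then x 0 else y k k)"

definition separated :: "nat \<Rightarrow> real \<Rightarrow> (nat \<Rightarrow> R3) \<Rightarrow> (nat \<Rightarrow> nat \<Rightarrow> R3) \<Rightarrow> bool" where
  "separated N \<beta> x y \<longleftrightarrow> (\<forall>j\<in>{1..<N}.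
     (\<forall>i\<in>{..<N} - {j}. \<beta> \<le> dist (x j) (y j i)) \<and> (\<forall>k\<in>{..<j}. \<beta> \<le> dist (pivot x y k) (y j j)))"

lemma pivot_measurable:
  assumes "k < N"
  shows "(\<lambda>w. pivot (fst w) (snd w) k)
    \<in> borel_measurable (config N \<Otimes>\<^sub>M PiM {1..<N} (\<lambda>_. config N))"
proof (cases "k = 0")
  case True
  then show ?thesis using assms by (simp add: pivot_def)
next
  case False
  then have "(\<lambda>w. snd w k) \<in> measurable (config N \<Otimes>\<^sub>M PiM {1..<N} (\<lambda>_. config N)) (config N)"
    using assms by (intro measurable_compose[OF measurable_snd measurable_component_singleton]) auto
  from measurable_compose[OF this measurable_component_singleton] False assms
  show ?thesis by (simp add: pivot_def)
qed

lemma separated_measurable: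
  "Measurable.pred (config N \<Otimes>\<^sub>M PiM {1..<N} (\<lambda>_. config N)) (\<lambda>w. separated N \<beta> (fst w) (snd w))"
proof -
  let ?M = "config N \<Otimes>\<^sub>M PiM {1..<N} (\<lambda>_. config N)"
  have y: "(\<lambda>w. snd w j i) \<in> borel_measurable ?M" if "j \<in> {1..<N}" "i < N" for j i
    using that
    by (intro measurable_compose[OF measurable_compose[OF measurable_snd
        measurable_component_singleton[of j "{1..<N}" "\<lambda>_. config N"]]
        measurable_component_singleton[of i "{..<N}" "\<lambda>_. borel"]]) auto
  have x: "(\<lambda>w. fst w j) \<in> borel_measurable ?M" if "j < N" for j
    using that by (intro measurable_compose[OF measurable_fst measurable_component_singleton]) auto
  have pd: "Measurable.pred ?M (\<lambda>w. \<beta> \<le> dist (f w) (g w))"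
    if [measurable]: "f \<in> borel_measurable ?M" "g \<in> borel_measurable ?M" for f g :: "_ \<Rightarrow> R3"
    by measurable
  show ?thesis
    unfolding separated_def
    by (intro pred_intros_finite pred_intros_logic pd y x pivot_measurable) auto
qed

text \<open>A union bound. For each \<open>j\<close> there are \<open>N - 1\<close> events that
  \<open>x j\<close> is near another point of \<open>y j\<close>, and \<open>j \<le> N - 1\<close>
  events that \<open>y j j\<close> is near an earlier pivot point. Each has probability at most
  \<open>\<kappa>\<close>: its centre is either fixed or a \<open>pivot x y k\<close> with
  \<open>k < j\<close>, which does not involve the sample \<open>y j\<close>.\<close>

lemma prob_separated_ge:
  fixes \<kappa> :: real
  assumes P: "prob_space P" "sets P = sets (config N)"
    and conc: "\<And>i z. i < N \<Longrightarrow> emeasure P {x\<in>space P. dist z (x i) < \<beta>} \<le> ennreal \<kappa>"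
    and x: "x \<in> space (config N)" and "\<kappa> \<ge> 0" "N > 0"
  shows "ennreal (1 - 2 * (real N - 1)^2 * \<kappa>)
    \<le> (\<integral>\<^sup>+y. indicator {y. separated N \<beta> x y} y \<partial>PiM {1..<N} (\<lambda>_. P))"
proof -
  interpret P: prob_space P by fact
  note One_nat_def[simp del]
  let ?\<Pi> = "PiM {1..<N} (\<lambda>_. P)"
  interpret Q: prob_space ?\<Pi> by (rule prob_space_PiM) (rule P)
  have s\<Pi>: "sets ?\<Pi> = sets (PiM {1..<N} (\<lambda>_. config N))"
    by (intro sets_PiM_cong) (auto simp: P)
  have y: "(\<lambda>y. y j i) \<in> borel_measurable ?\<Pi>" if "j \<in> {1..<N}" "i < N" for j i
    using that measurable_compose[OF measurable_component_singleton[of j "{1..<N}" "\<lambda>_. config N"]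
       measurable_component_singleton[of i "{..<N}" "\<lambda>_. borel"]]
    by (subst measurable_cong_sets[OF s\<Pi> refl]) auto
  have piv: "(\<lambda>y. pivot x y k) \<in> borel_measurable ?\<Pi>" if "k < N" for k
    using that y[of k k] by (cases "k = 0") (auto simp: pivot_def)
  let ?E = "\<lambda>j i. {y\<in>space ?\<Pi>. dist (x j) (y j i) < \<beta>}"
  let ?F = "\<lambda>j k. {y\<in>space ?\<Pi>. dist (pivot x y k) (y j j) < \<beta>}"
  have ms: "{y\<in>space ?\<Pi>. dist (f y) (g y) < \<beta>} \<in> sets ?\<Pi>"
    if [measurable]: "f \<in> borel_measurable ?\<Pi>" "g \<in> borel_measurable ?\<Pi>" for f g :: "_ \<Rightarrow> R3"
    by measurable
  have mE: "?E j i \<in> sets ?\<Pi>" if "j \<in> {1..<N}" "i < N" for j i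
    using that by (intro ms y) auto
  have mF: "?F j k \<in> sets ?\<Pi>" if "j \<in> {1..<N}" "k < j" for j k
    using that by (intro ms y piv) auto
  have E: "emeasure ?\<Pi> (?E j i) \<le> \<kappa>" if "j \<in> {1..<N}" "i < N" for j i
    using that by (intro prob_close_le P(1) conc) (auto simp: P)
  have F: "emeasure ?\<Pi> (?F j k) \<le> \<kappa>" if "j \<in> {1..<N}" "k < j" for j k
    using that by (intro prob_close_le P(1) conc piv) (auto simp: pivot_def P)
  define B where "B = (\<Union>j\<in>{1..<N}. (\<Union>i\<in>{..<N} - {j}. ?E j i) \<union> (\<Union>k\<in>{..<j}. ?F j k))"
  have mB[measurable]: "B \<in> sets ?\<Pi>"
    unfolding B_def using mE mF by (intro sets.finite_UN sets.Un) auto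
  have "emeasure ?\<Pi> B \<le> (\<Sum>j\<in>{1..<N}. emeasure ?\<Pi> ((\<Union>i\<in>{..<N} - {j}. ?E j i) \<union> (\<Union>k\<in>{..<j}. ?F j k)))"
    unfolding B_def using mE mF
    by (intro emeasure_subadditive_finite) (auto intro!: sets.finite_UN sets.Un)
  also have "\<dots> \<le> (\<Sum>j\<in>{1..<N}. (\<Sum>i\<in>{..<N} - {j}. emeasure ?\<Pi> (?E j i)) + (\<Sum>k\<in>{..<j}. emeasure ?\<Pi> (?F j k)))"
    using mE mF
    by (intro sum_mono order_trans[OF emeasure_subadditive] add_mono emeasure_subadditive_finite
        sets.finite_UN) auto
  also have "\<dots> \<le> (\<Sum>j\<in>{1..<N}. (\<Sum>i\<in>{..<N} - {j}. ennreal \<kappa>) + (\<Sum>k\<in>{..<N-1}. ennreal \<kappa>))"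
  proof (intro sum_mono add_mono)
    fix j assume j: "j \<in> {1..<N}"
    have "(\<Sum>k\<in>{..<j}. emeasure ?\<Pi> (?F j k)) \<le> (\<Sum>k\<in>{..<j}. ennreal \<kappa>)"
      using j by (intro sum_mono F) auto
    also have "\<dots> \<le> (\<Sum>k\<in>{..<N-1}. ennreal \<kappa>)"
      using j by (intro sum_mono2) auto
    finally show "(\<Sum>k\<in>{..<j}. emeasure ?\<Pi> (?F j k)) \<le> (\<Sum>k\<in>{..<N-1}. ennreal \<kappa>)" .
  qed (use E in auto)
  also have "\<dots> = of_nat (N - 1) * (of_nat (N - 1) * ennreal \<kappa> + of_nat (N - 1) * ennreal \<kappa>)"
    by simp
  also have "\<dots> = ennreal (real (N - 1) * (real (N - 1) * \<kappa> + real (N - 1) * \<kappa>))"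
    using assms(5)
    by (simp only: ennreal_of_nat_eq_real_of_nat ennreal_mult ennreal_plus of_nat_0_le_iff
        mult_nonneg_nonneg add_nonneg_nonneg)
  also have "real (N - 1) * (real (N - 1) * \<kappa> + real (N - 1) * \<kappa>) = 2 * (real N - 1)^2 * \<kappa>"
    using assms(6) by (simp add: of_nat_diff power2_eq_square algebra_simps)
  finally have B: "measure ?\<Pi> B \<le> 2 * (real N - 1)^2 * \<kappa>"
    using assms(5) by (simp add: Q.emeasure_eq_measure ennreal_le_iff)
  have "1 - 2 * (real N - 1)^2 * \<kappa> \<le> measure ?\<Pi> (space ?\<Pi> - B)"
    using B by (simp add: Q.prob_compl)
  then have "ennreal (1 - 2 * (real N - 1)^2 * \<kappa>) \<le> emeasure ?\<Pi> (space ?\<Pi> - B)"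
    by (simp add: Q.emeasure_eq_measure ennreal_leI)
  also have "\<dots> = (\<integral>\<^sup>+y. indicator (space ?\<Pi> - B) y \<partial>?\<Pi>)" by simp
  also have "\<dots> \<le> (\<integral>\<^sup>+y. indicator {y. separated N \<beta> x y} y \<partial>?\<Pi>)"
    by (intro nn_integral_mono) (force simp: indicator_def B_def separated_def not_less)
  finally show ?thesis .
qed

text \<open>The first component of \<open>J\<close> has law \<open>R\<close>; given
  \<open>x\<close>, the second is an independent sample from \<open>P\<close> conditioned on
  separation from \<open>x\<close>. Conditioning multiplies densities by at most
  \<open>1 / l\<close>, which controls the law of each \<open>y j\<close>.\<close>

lemma ex_separated_sample:
  fixes \<kappa> :: real
  assumes P: "prob_space P" "sets P = sets (config N)"
    and conc: "\<And>i z. i < N \<Longrightarrow> emeasure P {x\<in>space P. dist z (x i) < \<beta>} \<le> ennreal \<kappa>"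
    and "\<kappa> \<ge> 0" "N > 0" and l: "l = 1 - 2 * (real N - 1)^2 * \<kappa>" "l > 0"
    and R: "finite_measure R" "sets R = sets (config N)"
  obtains J where "sets J = sets (config N \<Otimes>\<^sub>M PiM {1..<N} (\<lambda>_. config N))"
    and "\<And>f. f \<in> borel_measurable (config N) \<Longrightarrow> (\<integral>\<^sup>+w. f (fst w) \<partial>J) = (\<integral>\<^sup>+x. f x \<partial>R)"
    and "\<And>f j. f \<in> borel_measurable (config N) \<Longrightarrow> j \<in> {1..<N} \<Longrightarrow>
      (\<integral>\<^sup>+w. f (snd w j) \<partial>J) \<le> emeasure R (space R) * ennreal (1 / l) * (\<integral>\<^sup>+x. f x \<partial>P)"
    and "AE w in J. separated N \<beta> (fst w) (snd w)"
proof -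
  note One_nat_def[simp del]
  let ?\<Pi> = "PiM {1..<N} (\<lambda>_. P)" and ?S = "PiM {1..<N} (\<lambda>_. config N)"
  interpret P: prob_space P by fact
  interpret R: finite_measure R by fact
  interpret Q: prob_space ?\<Pi> by (rule prob_space_PiM) (rule P)
  interpret PP: product_prob_space "\<lambda>_. P" "{1..<N}" by unfold_locales
  interpret RQ: pair_sigma_finite R ?\<Pi> by unfold_locales
  have s\<Pi>: "sets ?\<Pi> = sets ?S"
    by (intro sets_PiM_cong) (auto simp: P)
  have sM: "sets (R \<Otimes>\<^sub>M ?\<Pi>) = sets (config N \<Otimes>\<^sub>M ?S)"
    by (intro sets_pair_measure_cong s\<Pi> R)
  have spR: "space R = space (config N)" by (rule sets_eq_imp_space_eq) fact
  define g where "g w = (indicator {w. separated N \<beta> (fst w) (snd w)} w :: ennreal)" for w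
  have [measurable]: "Measurable.pred (R \<Otimes>\<^sub>M ?\<Pi>) (\<lambda>w. separated N \<beta> (fst w) (snd w))"
    by (subst measurable_cong_sets[OF sM refl]) (rule separated_measurable)
  have g[measurable]: "g \<in> borel_measurable (R \<Otimes>\<^sub>M ?\<Pi>)"
    unfolding g_def[abs_def] by measurable
  define Z where "Z x = (\<integral>\<^sup>+y. g (x, y) \<partial>?\<Pi>)" for x
  have Z[measurable]: "Z \<in> borel_measurable R"
    unfolding Z_def[abs_def] by measurable
  have Zge: "ennreal l \<le> Z x" if "x \<in> space R" for x
    using prob_separated_ge[OF P conc, of x] that assms(4,5)
    by (simp add: Z_def g_def l spR indicator_def)
  have Zle: "Z x \<le> 1" for x
  proof -
    have "Z x \<le> (\<integral>\<^sup>+y. 1 \<partial>?\<Pi>)" unfolding Z_def g_def by (intro nn_integral_mono) (auto simp: indicator_def)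
    then show ?thesis by (simp add: Q.emeasure_space_1)
  qed
  \<comment> \<open>The normalisation is done for each \<open>x\<close> separately:
    \<open>K (x, \<cdot>)\<close> has integral 1, so the first marginal stays exactly
    \<open>R\<close>.\<close>
  define K where "K w = g w / Z (fst w)" for w
  have K[measurable]: "K \<in> borel_measurable (R \<Otimes>\<^sub>M ?\<Pi>)"
    unfolding K_def[abs_def] by measurable
  define J where "J = density (R \<Otimes>\<^sub>M ?\<Pi>) K"
  show thesis
  proof (rule that)
    show "sets J = sets (config N \<Otimes>\<^sub>M ?S)" by (simp add: J_def sM)
  next
    fix f :: "(nat \<Rightarrow> R3) \<Rightarrow> ennreal" assume "f \<in> borel_measurable (config N)"
    then have [measurable]: "f \<in> borel_measurable R" by (simp add: measurable_cong_sets[OF R(2) refl])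
    have "(\<integral>\<^sup>+w. f (fst w) \<partial>J) = (\<integral>\<^sup>+w. K w * f (fst w) \<partial>(R \<Otimes>\<^sub>M ?\<Pi>))"
      unfolding J_def by (intro nn_integral_density) measurable
    also have "\<dots> = (\<integral>\<^sup>+x. (\<integral>\<^sup>+y. K (x, y) * f x \<partial>?\<Pi>) \<partial>R)"
      by (subst Q.nn_integral_fst[symmetric]) auto
    also have "\<dots> = (\<integral>\<^sup>+x. f x \<partial>R)"
    proof (intro nn_integral_cong)
      fix x assume x: "x \<in> space R"
      have "(\<integral>\<^sup>+y. K (x, y) * f x \<partial>?\<Pi>) = (\<integral>\<^sup>+y. g (x, y) * (f x / Z x) \<partial>?\<Pi>)"
        by (intro nn_integral_cong) (simp add: K_def divide_ennreal_def ac_simps)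
      also have "\<dots> = Z x * (f x / Z x)"
        unfolding Z_def using x by (intro nn_integral_multc) measurable
      \<comment> \<open>Cancelling \<open>Z x\<close> needs it to be neither 0 nor infinite, which
        the bounds \<open>l \<le> Z x \<le> 1\<close> provide.\<close>
      also have "\<dots> = f x"
        using Zge[OF x] Zle[of x] l(2)
        by (subst ennreal_times_divide, subst mult.commute, intro mult_divide_eq_ennreal)
          (auto simp: top_unique ennreal_eq_0_iff)
      finally show "(\<integral>\<^sup>+y. K (x, y) * f x \<partial>?\<Pi>) = f x" .
    qed
    finally show "(\<integral>\<^sup>+w. f (fst w) \<partial>J) = (\<integral>\<^sup>+x. f x \<partial>R)" .
  next
    fix f :: "(nat \<Rightarrow> R3) \<Rightarrow> ennreal" and j assume f: "f \<in> borel_measurable (config N)" and j: "j \<in> {1..<N}"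
    from f have [measurable]: "f \<in> borel_measurable P" by (simp add: measurable_cong_sets[OF P(2) refl])
    have [measurable]: "(\<lambda>y. y j) \<in> measurable ?\<Pi> P" using j by measurable
    have "(\<integral>\<^sup>+w. f (snd w j) \<partial>J) = (\<integral>\<^sup>+w. K w * f (snd w j) \<partial>(R \<Otimes>\<^sub>M ?\<Pi>))"
      unfolding J_def by (intro nn_integral_density) measurable
    also have "\<dots> = (\<integral>\<^sup>+x. (\<integral>\<^sup>+y. K (x, y) * f (y j) \<partial>?\<Pi>) \<partial>R)"
      by (subst Q.nn_integral_fst[symmetric]) auto
    also have "\<dots> \<le> (\<integral>\<^sup>+x. (\<integral>\<^sup>+y. ennreal (1 / l) * f (y j) \<partial>?\<Pi>) \<partial>R)"
    proof (intro nn_integral_mono mult_right_mono)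
      fix x y assume x: "x \<in> space R"
      have "K (x, y) \<le> 1 / Z x"
        by (simp add: K_def g_def indicator_def)
      also have "\<dots> \<le> ennreal (1 / l)"
      proof (cases "Z x")
        case (real z)
        then have "l \<le> z" using Zge[OF x] l(2) by (simp add: ennreal_le_iff)
        then show ?thesis
          using l(2) real divide_ennreal[of 1 z] by (simp add: ennreal_leI frac_le)
      qed (use Zle[of x] in \<open>simp add: top_unique\<close>)
      finally show "K (x, y) \<le> ennreal (1 / l)" .
    qed auto
    also have "\<dots> = (\<integral>\<^sup>+x. ennreal (1 / l) * (\<integral>\<^sup>+y. f (y j) \<partial>?\<Pi>) \<partial>R)"
      by (intro nn_integral_cong nn_integral_cmult) measurable
    also have "(\<integral>\<^sup>+y. f (y j) \<partial>?\<Pi>) = (\<integral>\<^sup>+x. f x \<partial>distr ?\<Pi> P (\<lambda>y. y j))"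
      by (rule nn_integral_distr[symmetric]) (use j in simp_all)
    also have "distr ?\<Pi> P (\<lambda>y. y j) = P"
      using PP.PiM_component[OF j] .
    finally show "(\<integral>\<^sup>+w. f (snd w j) \<partial>J) \<le> emeasure R (space R) * ennreal (1 / l) * (\<integral>\<^sup>+x. f x \<partial>P)"
      by (simp add: ac_simps)
  next
    show "AE w in J. separated N \<beta> (fst w) (snd w)"
      unfolding J_def by (subst AE_density) (auto simp: K_def g_def indicator_def)
  qed
qed

section \<open>The exchange\<close>

text \<open>The \<open>N\<close> outcomes of one exchange: index 0 is what becomes of
  \<open>x\<close>, index \<open>j > 0\<close> what becomes of \<open>y j\<close>. The restriction
  to \<open>{..<N}\<close> keeps the pivot configuration extensional, as membership in the space of
  \<open>config N\<close> demands.\<close>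

definition swapped :: "nat \<Rightarrow> nat \<Rightarrow> (nat \<Rightarrow> R3) \<times> (nat \<Rightarrow> nat \<Rightarrow> R3) \<Rightarrow> nat \<Rightarrow> R3" where
  "swapped N j w = (if j = 0 then (\<lambda>k\<in>{..<N}. pivot (fst w) (snd w) k) else (snd w j)(j := fst w j))"

lemma swapped_measurable:
  assumes "j < N"
  shows "swapped N j \<in> measurable (config N \<Otimes>\<^sub>M PiM {1..<N} (\<lambda>_. config N)) (config N)"
proof (cases "j = 0")
  case True
  then show ?thesis
    unfolding swapped_def[abs_def]
    by (auto simp del: One_nat_def intro!: measurable_restrict pivot_measurable)
next
  case False
  let ?M = "config N \<Otimes>\<^sub>M PiM {1..<N} (\<lambda>_. config N)"
  have y: "(\<lambda>w. snd w j) \<in> measurable ?M (config N)"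
    using False assms
    by (intro measurable_compose[OF measurable_snd measurable_component_singleton]) auto
  have "(\<lambda>w. (snd w j)(j := fst w j)) \<in> measurable ?M (config N)"
    using assms
    by (intro measurable_fun_upd[where J="{..<N}"] y measurable_compose[OF measurable_fst]
        measurable_component_singleton) auto
  then show ?thesis
    using False unfolding swapped_def[abs_def] by simp
qed

text \<open>In the pivot configuration every pair is separated. In the other outcomes only pairs
  containing the index \<open>j\<close> are new, and these are separated too; all other pairs keep
  their cost from \<open>y j\<close>. The cost of \<open>x\<close> never enters.\<close>

lemma pairsum_swapped:
  assumes sep: "separated N \<beta> (fst w) (snd w)" and \<psi>: "\<And>t. \<beta> \<le> t \<Longrightarrow> \<psi> t \<le> A" and "j < N"
  shows "pairsum \<psi> N (swapped N j w)
    \<le> (if j = 0 then 0 else pairsum \<psi> N (snd w j)) + of_nat N ^ 2 * A"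
proof (cases "j = 0")
  case True
  have "pairsum \<psi> N (swapped N j w) \<le> of_nat N ^ 2 * A"
  proof (rule pairsum_le_const)
    fix i k assume ik: "i < k" "k < N"
    then have "\<beta> \<le> dist (pivot (fst w) (snd w) i) (snd w k k)"
      using sep unfolding separated_def by auto
    then show "\<psi> (norm (swapped N j w i - swapped N j w k)) \<le> A"
      using ik True by (intro \<psi>) (auto simp: swapped_def dist_norm pivot_def)
  qed
  then show ?thesis using True by simp
next
  case False
  have d: "\<beta> \<le> dist (fst w j) (snd w j i)" if "i < N" "i \<noteq> j" for i
    using sep that False \<open>j < N\<close> unfolding separated_def by auto
  have "pairsum \<psi> N (swapped N j w) \<le> pairsum \<psi> N (snd w j) + of_nat N ^ 2 * A"
  proof (rule pairsum_le)
    fix i k assume ik: "i < k" "k < N"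
    show "\<psi> (norm (swapped N j w i - swapped N j w k)) \<le> \<psi> (norm (snd w j i - snd w j k)) + A"
    proof (cases "i = j \<or> k = j")
      case True
      then have "\<beta> \<le> norm (swapped N j w i - swapped N j w k)"
        using d[of i] d[of k] ik False
        by (auto simp: swapped_def dist_norm norm_minus_commute)
      then show ?thesis by (intro order_trans[OF \<psi>]) auto
    next
      case False2: False
      then show ?thesis using False by (auto simp: swapped_def)
    qed
  qed
  then show ?thesis using False by simp
qed

text \<open>Here \<open>T\<close> is \<open>a P - Y + W\<close>, where \<open>Y\<close> sums the
  laws of the samples that are used up and \<open>W\<close> the laws of the \<open>N\<close>
  outcomes. At each coordinate the outcomes carry the points of \<open>x\<close> and of all
  \<open>y j\<close>, so \<open>R\<close> is absorbed with its marginals while its own cost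
  disappears from the bound.\<close>

lemma exchange:
  fixes \<kappa> a :: real
  assumes P: "prob_space P" "sets P = sets (config N)"
    and conc: "\<And>i z. i < N \<Longrightarrow> emeasure P {x\<in>space P. dist z (x i) < \<beta>} \<le> ennreal \<kappa>"
    and "\<kappa> \<ge> 0" "N > 0" and l: "l = 1 - 2 * (real N - 1)^2 * \<kappa>" "l > 0"
    and R: "finite_measure R" "sets R = sets (config N)"
    and a: "a \<ge> 0" "measure R (space R) * (real N - 1) \<le> a * l"
  obtains T where "sets T = sets (config N)"
    and "\<And>f i. f \<in> borel_measurable borel \<Longrightarrow> i < N \<Longrightarrow>
      (\<integral>\<^sup>+x. f (x i) \<partial>T) = ennreal a * (\<integral>\<^sup>+x. f (x i) \<partial>P) + (\<integral>\<^sup>+x. f (x i) \<partial>R)"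
    and "\<And>\<psi> A. \<psi> \<in> borel_measurable borel \<Longrightarrow> (\<And>t. \<beta> \<le> t \<Longrightarrow> \<psi> t \<le> A) \<Longrightarrow>
      (\<integral>\<^sup>+x. pairsum \<psi> N x \<partial>T)
        \<le> ennreal a * (\<integral>\<^sup>+x. pairsum \<psi> N x \<partial>P) + of_nat N ^ 3 * A * emeasure R (space R)"
proof -
  note One_nat_def[simp del]
  let ?C = "config N" and ?M = "config N \<Otimes>\<^sub>M PiM {1..<N} (\<lambda>_. config N)"
  interpret P: prob_space P by fact
  interpret R: finite_measure R by fact
  obtain J where J: "sets J = sets ?M"
    and J_fst: "\<And>f. f \<in> borel_measurable ?C \<Longrightarrow> (\<integral>\<^sup>+w. f (fst w) \<partial>J) = (\<integral>\<^sup>+x. f x \<partial>R)"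
    and J_snd: "\<And>f j. f \<in> borel_measurable ?C \<Longrightarrow> j \<in> {1..<N} \<Longrightarrow>
      (\<integral>\<^sup>+w. f (snd w j) \<partial>J) \<le> emeasure R (space R) * ennreal (1 / l) * (\<integral>\<^sup>+x. f x \<partial>P)"
    and J_sep: "AE w in J. separated N \<beta> (fst w) (snd w)"
    by (rule ex_separated_sample[OF P conc assms(4,5) l R]) (assumption | blast)+
  have mJ: "measurable J L = measurable ?M L" for L :: "'z measure"
    by (rule measurable_cong_sets[OF J refl])
  have mP: "measurable P L = measurable ?C L" for L :: "'z measure"
    by (rule measurable_cong_sets[OF P(2) refl])
  have J_space: "emeasure J (space J) = emeasure R (space R)"
    using J_fst[of "\<lambda>_. 1"] by simp
  have y: "(\<lambda>w. snd w j) \<in> measurable J ?C" if "j \<in> {1..<N}" for j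
    unfolding mJ using that
    by (intro measurable_compose[OF measurable_snd measurable_component_singleton]) auto
  have sw: "swapped N j \<in> measurable J ?C" if "j < N" for j
    unfolding mJ using that by (rule swapped_measurable)
  obtain Y where Y: "sets Y = sets ?C"
    and Y_int: "\<And>f. f \<in> borel_measurable ?C \<Longrightarrow>
      (\<integral>\<^sup>+x. f x \<partial>Y) = (\<Sum>j\<in>{1..<N}. \<integral>\<^sup>+x. f x \<partial>distr J ?C (\<lambda>w. snd w j))"
    by (rule ex_measure_sum[of "{1..<N}" "\<lambda>j. distr J ?C (\<lambda>w. snd w j)" ?C]) auto
  have Y_int': "(\<integral>\<^sup>+x. f x \<partial>Y) = (\<Sum>j\<in>{1..<N}. \<integral>\<^sup>+w. f (snd w j) \<partial>J)"
    if "f \<in> borel_measurable ?C" for f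
    unfolding Y_int[OF that] using y that by (intro sum.cong refl nn_integral_distr) auto
  obtain W where W: "sets W = sets ?C"
    and W_int: "\<And>f. f \<in> borel_measurable ?C \<Longrightarrow>
      (\<integral>\<^sup>+x. f x \<partial>W) = (\<Sum>j\<in>{..<N}. \<integral>\<^sup>+x. f x \<partial>distr J ?C (swapped N j))"
    by (rule ex_measure_sum[of "{..<N}" "\<lambda>j. distr J ?C (swapped N j)" ?C]) auto
  have W_int': "(\<integral>\<^sup>+x. f x \<partial>W) = (\<Sum>j\<in>{..<N}. \<integral>\<^sup>+w. f (swapped N j w) \<partial>J)"
    if "f \<in> borel_measurable ?C" for f
    unfolding W_int[OF that] using sw that by (intro sum.cong refl nn_integral_distr) auto
  \<comment> \<open>There must be enough of \<open>a P\<close> to draw the samples from: each of the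
    \<open>N - 1\<close> laws is at most the mass of \<open>R\<close> divided by \<open>l\<close>,
    times \<open>P\<close>, and the hypothesis on \<open>a\<close> says that their sum fits.\<close>
  have YP: "emeasure Y B \<le> emeasure (scale_measure a P) B" if B: "B \<in> sets ?C" for B
  proof -
    have "emeasure Y B = (\<integral>\<^sup>+x. indicator B x \<partial>Y)" using B Y by simp
    also have "\<dots> = (\<Sum>j\<in>{1..<N}. \<integral>\<^sup>+w. indicator B (snd w j) \<partial>J)"
      using B by (intro Y_int') auto
    also have "\<dots> \<le> (\<Sum>j\<in>{1..<N}. emeasure R (space R) * ennreal (1 / l) * (\<integral>\<^sup>+x. indicator B x \<partial>P))"
      using B by (intro sum_mono J_snd) auto
    also have "\<dots> = ennreal (real N - 1) * (emeasure R (space R) * ennreal (1 / l) * emeasure P B)"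
      using B P \<open>N > 0\<close> by (simp add: ennreal_of_nat_eq_real_of_nat of_nat_diff)
    also have "\<dots> = ennreal (measure R (space R) * (real N - 1) / l) * emeasure P B"
      using \<open>N > 0\<close> l(2)
      by (simp add: R.emeasure_eq_measure P.emeasure_eq_measure ennreal_mult[symmetric] ac_simps)
    also have "\<dots> \<le> ennreal a * emeasure P B"
      using a l(2) by (intro mult_right_mono ennreal_leI) (auto simp: field_simps)
    finally show ?thesis by simp
  qed
  have "finite_measure (scale_measure a P)"
    by (rule finite_measureI) (simp add: space_scale_measure P.emeasure_space_1)
  from this obtain D where D: "sets D = sets ?C"
    and D_int: "\<And>f. f \<in> borel_measurable ?C \<Longrightarrow>
      (\<integral>\<^sup>+x. f x \<partial>scale_measure a P) = (\<integral>\<^sup>+x. f x \<partial>D) + (\<integral>\<^sup>+x. f x \<partial>Y)"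
    by (rule ex_measure_diff[of "scale_measure a P" ?C Y]) (use P Y YP in auto)
  have D_int': "ennreal a * (\<integral>\<^sup>+x. f x \<partial>P) = (\<integral>\<^sup>+x. f x \<partial>D) + (\<integral>\<^sup>+x. f x \<partial>Y)"
    if "f \<in> borel_measurable ?C" for f
    using D_int[OF that] that by (simp add: nn_integral_scale_measure mP)
  obtain T where T: "sets T = sets ?C"
    and T_int: "\<And>f. f \<in> borel_measurable ?C \<Longrightarrow> (\<integral>\<^sup>+x. f x \<partial>T) = (\<integral>\<^sup>+x. f x \<partial>D) + (\<integral>\<^sup>+x. f x \<partial>W)"
    by (rule ex_measure_add[OF D W]) blast
  show thesis
  proof (rule that[OF T])
    fix f :: "R3 \<Rightarrow> ennreal" and i assume [measurable]: "f \<in> borel_measurable borel" and i: "i < N"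
    have fi: "(\<lambda>x. f (x i)) \<in> borel_measurable ?C"
      using i by (intro measurable_compose[OF measurable_component_singleton[of i "{..<N}" "\<lambda>_. borel"]]) auto
    let ?x = "\<integral>\<^sup>+w. f (fst w i) \<partial>J" and ?y = "\<lambda>j. \<integral>\<^sup>+w. f (snd w j i) \<partial>J"
    have 0: "{..<N} = insert 0 {1..<N}" using \<open>N > 0\<close> by auto
    \<comment> \<open>At coordinate 0 nothing moves. At coordinate \<open>i > 0\<close> the outcomes
      0 and \<open>i\<close> trade \<open>x i\<close> for \<open>y i i\<close>, and the others are
      unchanged.\<close>
    have "(\<Sum>j\<in>{..<N}. \<integral>\<^sup>+w. f (swapped N j w i) \<partial>J) = ?x + (\<Sum>j\<in>{1..<N}. ?y j)"
    proof (cases "i = 0")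
      case True
      then show ?thesis
        using i unfolding 0 by (simp add: swapped_def pivot_def)
    next
      case False
      then have i': "i \<in> {1..<N}" using i by auto
      have "(\<Sum>j\<in>{..<N}. \<integral>\<^sup>+w. f (swapped N j w i) \<partial>J)
          = ?y i + (\<Sum>j\<in>{1..<N}. if j = i then ?x else ?y j)"
        using i False unfolding 0
        by (simp add: swapped_def pivot_def if_distrib cong: if_cong) (auto intro!: sum.cong)
      also have "\<dots> = ?y i + (?x + (\<Sum>j\<in>{1..<N} - {i}. ?y j))"
        using i' by (subst sum.remove[of _ i]) (auto intro!: sum.cong)
      also have "\<dots> = ?x + (?y i + (\<Sum>j\<in>{1..<N} - {i}. ?y j))" by (simp add: ac_simps)
      also have "?y i + (\<Sum>j\<in>{1..<N} - {i}. ?y j) = (\<Sum>j\<in>{1..<N}. ?y j)"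
        using i' by (subst sum.remove[of _ i]) auto
      finally show ?thesis .
    qed
    then show "(\<integral>\<^sup>+x. f (x i) \<partial>T) = ennreal a * (\<integral>\<^sup>+x. f (x i) \<partial>P) + (\<integral>\<^sup>+x. f (x i) \<partial>R)"
      using T_int[OF fi] D_int'[OF fi] W_int'[OF fi] Y_int'[OF fi] J_fst[OF fi]
      by (simp add: ac_simps)
  next
    fix \<psi> :: "real \<Rightarrow> ennreal" and A
    assume \<psi>: "\<psi> \<in> borel_measurable borel" and A: "\<And>t. \<beta> \<le> t \<Longrightarrow> \<psi> t \<le> A"
    note ps = pairsum_measurable[OF \<psi>, of N]
    have "(\<integral>\<^sup>+x. pairsum \<psi> N x \<partial>W) = (\<Sum>j\<in>{..<N}. \<integral>\<^sup>+w. pairsum \<psi> N (swapped N j w) \<partial>J)"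
      by (rule W_int'[OF ps])
    \<comment> \<open>Each of the \<open>N\<close> outcomes adds at most \<open>N ^ 2 * A\<close> on
      a measure with the mass of \<open>R\<close>, whence the cube; the sampled costs add up to the
      cost of \<open>Y\<close>, which was removed from \<open>a P\<close>.\<close>
    also have "\<dots> \<le> (\<Sum>j\<in>{..<N}. \<integral>\<^sup>+w. (if j = 0 then 0 else pairsum \<psi> N (snd w j)) + of_nat N ^ 2 * A \<partial>J)"
    proof (intro sum_mono nn_integral_mono_AE)
      fix j assume j: "j \<in> {..<N}"
      show "AE w in J. pairsum \<psi> N (swapped N j w)
          \<le> (if j = 0 then 0 else pairsum \<psi> N (snd w j)) + of_nat N ^ 2 * A"
        using J_sep by eventually_elim (rule pairsum_swapped, use j A in auto)
    qed
    also have "\<dots> = (\<Sum>j\<in>{..<N}. (\<integral>\<^sup>+w. (if j = 0 then 0 else pairsum \<psi> N (snd w j)) \<partial>J) + of_nat N ^ 2 * A * emeasure R (space R))"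
    proof (intro sum.cong refl)
      fix j assume "j \<in> {..<N}"
      then have "(\<lambda>w. if j = 0 then 0 else pairsum \<psi> N (snd w j)) \<in> borel_measurable J"
        using measurable_compose[OF y ps, of j] by (cases "j = 0") auto
      then show "(\<integral>\<^sup>+w. (if j = 0 then 0 else pairsum \<psi> N (snd w j)) + of_nat N ^ 2 * A \<partial>J)
        = (\<integral>\<^sup>+w. (if j = 0 then 0 else pairsum \<psi> N (snd w j)) \<partial>J) + of_nat N ^ 2 * A * emeasure R (space R)"
        by (subst nn_integral_add) (auto simp: J_space)
    qed
    also have "\<dots> = (\<Sum>j\<in>{..<N}. \<integral>\<^sup>+w. (if j = 0 then 0 else pairsum \<psi> N (snd w j)) \<partial>J) + of_nat N ^ 3 * A * emeasure R (space R)"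
      by (simp add: sum.distrib power3_eq_cube power2_eq_square mult.assoc)
    also have "(\<Sum>j\<in>{..<N}. \<integral>\<^sup>+w. (if j = 0 then 0 else pairsum \<psi> N (snd w j)) \<partial>J)
        = (\<Sum>j\<in>{1..<N}. \<integral>\<^sup>+w. pairsum \<psi> N (snd w j) \<partial>J)"
      by (intro sum.mono_neutral_cong_right) auto
    also have "\<dots> = (\<integral>\<^sup>+x. pairsum \<psi> N x \<partial>Y)"
      by (rule Y_int'[OF ps, symmetric])
    finally have "(\<integral>\<^sup>+x. pairsum \<psi> N x \<partial>W)
      \<le> (\<integral>\<^sup>+x. pairsum \<psi> N x \<partial>Y) + of_nat N ^ 3 * A * emeasure R (space R)" .
    then show "(\<integral>\<^sup>+x. pairsum \<psi> N x \<partial>T)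
        \<le> ennreal a * (\<integral>\<^sup>+x. pairsum \<psi> N x \<partial>P) + of_nat N ^ 3 * A * emeasure R (space R)"
      unfolding T_int[OF ps] D_int'[OF ps] by (simp add: add.assoc add_left_mono)
  qed
qed

section \<open>Transport plans\<close>

lemma coord_measurable:
  "f \<in> measurable borel M \<Longrightarrow> i < N \<Longrightarrow> (\<lambda>x. f (x i)) \<in> measurable (config N) M"
  by (intro measurable_compose[OF measurable_component_singleton[of i "{..<N}" "\<lambda>_. borel"]]) auto

lemma transport_plansI:
  assumes \<rho>: "borel_prob \<rho>" and P: "sets P = sets (config N)" and "N > 0"
    and marg: "\<And>f i. f \<in> borel_measurable borel \<Longrightarrow> i < N \<Longrightarrow>
      (\<integral>\<^sup>+x. f (x i) \<partial>P) = (\<integral>\<^sup>+x. f x \<partial>\<rho>)"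
  shows "P \<in> transport_plans N \<rho>"
proof -
  interpret \<rho>: prob_space \<rho> using \<rho> by (simp add: borel_prob_def)
  have s: "sets \<rho> = sets borel" using \<rho> by (simp add: borel_prob_def)
  have mP: "measurable P L = measurable (config N) L" for L :: "'z measure"
    by (rule measurable_cong_sets[OF P refl])
  have "prob_space P"
    using marg[of "\<lambda>_. 1" 0] \<open>N > 0\<close> by (intro prob_spaceI) (simp add: \<rho>.emeasure_space_1)
  moreover have "distr P borel (\<lambda>x. x i) = \<rho>" if i: "i < N" for i
  proof (rule measure_eqI)
    fix A assume A: "A \<in> sets (distr P borel (\<lambda>x. x i))"
    have c: "(\<lambda>x. x i) \<in> measurable P borel"
      unfolding mP using i by (intro measurable_component_singleton) auto
    have "emeasure (distr P borel (\<lambda>x. x i)) A = (\<integral>\<^sup>+x. indicator A x \<partial>distr P borel (\<lambda>x. x i))"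
      using A by (intro nn_integral_indicator[symmetric])
    also have "\<dots> = (\<integral>\<^sup>+x. indicator A (x i) \<partial>P)"
      using A by (intro nn_integral_distr c) auto
    also have "\<dots> = (\<integral>\<^sup>+x. indicator A x \<partial>\<rho>)" using A i by (intro marg) auto
    also have "\<dots> = emeasure \<rho> A" using A s by (intro nn_integral_indicator) auto
    finally show "emeasure (distr P borel (\<lambda>x. x i)) A = emeasure \<rho> A" .
  qed (simp add: s)
  ultimately show ?thesis using P by (simp add: transport_plans_def)
qed

lemma transport_plans_marginal:
  assumes P: "P \<in> transport_plans N \<rho>" and f: "f \<in> borel_measurable borel" "i < N"
  shows "(\<integral>\<^sup>+x. f (x i) \<partial>P) = (\<integral>\<^sup>+x. f x \<partial>\<rho>)"
proof -
  have s: "sets P = sets (config N)" using P by (simp add: transport_plans_def)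
  have c: "(\<lambda>x. x i) \<in> measurable P borel"
    using f(2) by (subst measurable_cong_sets[OF s refl]) (auto intro!: measurable_component_singleton)
  have "\<rho> = distr P borel (\<lambda>x. x i)" using P f(2) by (simp add: transport_plans_def)
  then have "(\<integral>\<^sup>+x. f x \<partial>\<rho>) = (\<integral>\<^sup>+x. f x \<partial>distr P borel (\<lambda>x. x i))" by simp
  also have "\<dots> = (\<integral>\<^sup>+x. f (x i) \<partial>P)" using c f by (intro nn_integral_distr) auto
  finally show ?thesis ..
qed

lemma measure_ball_le_concentration:
  assumes "borel_prob \<rho>"
  shows "measure \<rho> (ball z r) \<le> concentration \<rho> r"
proof -
  interpret prob_space \<rho> using assms by (simp add: borel_prob_def)
  show ?thesis
    unfolding concentration_def by (intro cSUP_upper bdd_aboveI[of _ 1]) auto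
qed

lemma concentration_nonneg: "borel_prob \<rho> \<Longrightarrow> 0 \<le> concentration \<rho> r"
  using measure_ball_le_concentration[of \<rho> 0 r] measure_nonneg[of \<rho> "ball 0 r"] by linarith

text \<open>This turns concentration of the marginal into the hypothesis on \<open>P\<close> that
  the sampling and exchange lemmas use.\<close>

lemma transport_plans_close_le:
  assumes \<rho>: "borel_prob \<rho>" and P: "P \<in> transport_plans N \<rho>" and i: "i < N"
  shows "emeasure P {x\<in>space P. dist z (x i) < \<beta>} \<le> ennreal (concentration \<rho> \<beta>)"
proof -
  interpret \<rho>: prob_space \<rho> using \<rho> by (simp add: borel_prob_def)
  have s: "sets P = sets (config N)" using P by (simp add: transport_plans_def)
  have "{x\<in>space P. x i \<in> ball z \<beta>} \<in> sets P"
    using measurable_sets[OF coord_measurable[OF measurable_ident_sets[OF refl] i], of "ball z \<beta>"]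
    by (simp add: s sets_eq_imp_space_eq[OF s] vimage_def Int_def conj_commute)
  then have "emeasure P {x\<in>space P. dist z (x i) < \<beta>}
      = (\<integral>\<^sup>+x. indicator {x\<in>space P. x i \<in> ball z \<beta>} x \<partial>P)"
    by (simp add: mem_ball)
  also have "\<dots> = (\<integral>\<^sup>+x. indicator (ball z \<beta>) (x i) \<partial>P)"
    by (intro nn_integral_cong) (auto simp: indicator_def)
  also have "\<dots> = (\<integral>\<^sup>+x. indicator (ball z \<beta>) x \<partial>\<rho>)"
    by (intro transport_plans_marginal[OF P _ i] borel_measurable_indicator borel_open open_ball)
  also have "\<dots> = ennreal (measure \<rho> (ball z \<beta>))"
    using \<rho> by (simp add: borel_prob_def \<rho>.emeasure_eq_measure)
  also have "\<dots> \<le> ennreal (concentration \<rho> \<beta>)"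
    by (intro ennreal_leI measure_ball_le_concentration \<rho>)
  finally show ?thesis .
qed

text \<open>\<open>Q\<close> and \<open>R\<close> split something with the right marginals into a
  part worth keeping and a part to be destroyed. The new plan is \<open>e Q\<close> plus the result
  of exchanging \<open>e R\<close> against \<open>(1 - e) P\<close>, with \<open>e = l / N\<close>.
  The cost of \<open>R\<close> is absent from the bound, so it may be infinite.\<close>

lemma ex_improved_plan:
  assumes \<rho>: "borel_prob \<rho>" and "N > 0"
    and l: "l = 1 - 2 * (real N - 1)^2 * concentration \<rho> \<beta>" "l > 0"
    and P: "P \<in> transport_plans N \<rho>"
    and QR: "sets Q = sets (config N)" "sets R = sets (config N)"
      "\<And>f i. f \<in> borel_measurable borel \<Longrightarrow> i < N \<Longrightarrow>
        (\<integral>\<^sup>+x. f (x i) \<partial>Q) + (\<integral>\<^sup>+x. f (x i) \<partial>R) = (\<integral>\<^sup>+x. f x \<partial>\<rho>)"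
  obtains T where "T \<in> transport_plans N \<rho>"
    and "\<And>\<psi> A. \<psi> \<in> borel_measurable borel \<Longrightarrow> (\<And>t. \<beta> \<le> t \<Longrightarrow> \<psi> t \<le> A) \<Longrightarrow>
      (\<integral>\<^sup>+x. pairsum \<psi> N x \<partial>T) \<le> ennreal (1 - l / N) * (\<integral>\<^sup>+x. pairsum \<psi> N x \<partial>P)
        + ennreal (l / N) * ((\<integral>\<^sup>+x. pairsum \<psi> N x \<partial>Q) + of_nat N ^ 3 * A * emeasure R (space R))"
proof -
  interpret \<rho>: prob_space \<rho> using \<rho> by (simp add: borel_prob_def)
  define e where "e = l / real N"
  have l1: "l \<le> 1" using concentration_nonneg[OF \<rho>, of \<beta>] l by simp
  \<comment> \<open>The last inequality is the mass condition of the exchange. With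
    \<open>e = l / N\<close> it reads \<open>l - l / N \<le> l - l ^ 2 / N\<close>, which holds as
    \<open>l \<le> 1\<close>.\<close>
  have e: "0 < e" "e \<le> 1" "e * (real N - 1) \<le> (1 - e) * l"
    using l(2) l1 \<open>N > 0\<close> mult_left_mono[of l 1 l]
    by (auto simp: e_def field_simps)
  have P': "prob_space P" "sets P = sets (config N)" using P by (auto simp: transport_plans_def)
  note mQ = measurable_cong_sets[OF QR(1) refl] and mR = measurable_cong_sets[OF QR(2) refl]
  have "emeasure Q (space Q) + emeasure R (space R) = 1"
    using QR(3)[of "\<lambda>_. 1" 0] \<open>N > 0\<close> by (simp add: \<rho>.emeasure_space_1)
  then have R1: "emeasure R (space R) \<le> 1"
    by (metis add.commute le_iff_add)
  have fR: "finite_measure R" by (rule finite_measureI) (use R1 in \<open>auto simp: top_unique\<close>)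
  then interpret R: finite_measure R .
  let ?R = "scale_measure e R"
  have fR': "finite_measure ?R"
    by (rule finite_measureI) (use R1 in \<open>auto simp: space_scale_measure ennreal_mult_eq_top_iff top_unique\<close>)
  have R1': "measure R (space R) \<le> 1" using R1 by (simp add: R.emeasure_eq_measure)
  have mR': "measure ?R (space ?R) * (real N - 1) \<le> (1 - e) * l"
  proof -
    have "measure ?R (space ?R) * (real N - 1) = measure R (space R) * (e * (real N - 1))"
      using e by (simp add: space_scale_measure measure_def enn2real_mult)
    also have "\<dots> \<le> 1 * (e * (real N - 1))"
      using e R1' \<open>N > 0\<close> by (intro mult_right_mono) auto
    also have "\<dots> \<le> (1 - e) * l" using e by simp
    finally show ?thesis .
  qed
  obtain T' where T': "sets T' = sets (config N)"
    and T'_marg: "\<And>f i. f \<in> borel_measurable borel \<Longrightarrow> i < N \<Longrightarrow>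
      (\<integral>\<^sup>+x. f (x i) \<partial>T') = ennreal (1 - e) * (\<integral>\<^sup>+x. f (x i) \<partial>P) + (\<integral>\<^sup>+x. f (x i) \<partial>?R)"
    and T'_cost: "\<And>\<psi> A. \<psi> \<in> borel_measurable borel \<Longrightarrow> (\<And>t. \<beta> \<le> t \<Longrightarrow> \<psi> t \<le> A) \<Longrightarrow>
      (\<integral>\<^sup>+x. pairsum \<psi> N x \<partial>T')
        \<le> ennreal (1 - e) * (\<integral>\<^sup>+x. pairsum \<psi> N x \<partial>P) + of_nat N ^ 3 * A * emeasure ?R (space ?R)"
    by (rule exchange[OF P' transport_plans_close_le[OF \<rho> P] concentration_nonneg[OF \<rho>] \<open>N > 0\<close> l fR' _ _ mR'])
      (assumption | use QR e in simp | blast)+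
  let ?Q = "scale_measure e Q"
  have sQ: "sets ?Q = sets (config N)" by (simp add: QR)
  obtain T where T: "sets T = sets (config N)"
    and T_int: "\<And>f. f \<in> borel_measurable (config N) \<Longrightarrow>
      (\<integral>\<^sup>+x. f x \<partial>T) = (\<integral>\<^sup>+x. f x \<partial>T') + (\<integral>\<^sup>+x. f x \<partial>?Q)"
    using ex_measure_add[OF T' sQ] by blast
  show thesis
  proof (rule that)
    show "T \<in> transport_plans N \<rho>"
    proof (rule transport_plansI[OF \<rho> T \<open>N > 0\<close>])
      fix f :: "R3 \<Rightarrow> ennreal" and i assume f: "f \<in> borel_measurable borel" and i: "i < N"
      have fi: "(\<lambda>x. f (x i)) \<in> borel_measurable (config N)" using f i by (rule coord_measurable)
      have "(\<integral>\<^sup>+x. f (x i) \<partial>?Q) = ennreal e * (\<integral>\<^sup>+x. f (x i) \<partial>Q)"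
        "(\<integral>\<^sup>+x. f (x i) \<partial>?R) = ennreal e * (\<integral>\<^sup>+x. f (x i) \<partial>R)"
        using fi by (simp_all add: nn_integral_scale_measure mQ mR)
      then have "(\<integral>\<^sup>+x. f (x i) \<partial>T) = ennreal (1 - e) * (\<integral>\<^sup>+x. f x \<partial>\<rho>)
          + ennreal e * (\<integral>\<^sup>+x. f (x i) \<partial>R) + ennreal e * (\<integral>\<^sup>+x. f (x i) \<partial>Q)"
        by (simp add: T_int[OF fi] T'_marg[OF f i] transport_plans_marginal[OF P f i])
      also have "\<dots> = ennreal (1 - e) * (\<integral>\<^sup>+x. f x \<partial>\<rho>)
          + ennreal e * ((\<integral>\<^sup>+x. f (x i) \<partial>Q) + (\<integral>\<^sup>+x. f (x i) \<partial>R))"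
        by (simp only: distrib_left ac_simps)
      also have "\<dots> = (ennreal (1 - e) + ennreal e) * (\<integral>\<^sup>+x. f x \<partial>\<rho>)"
        using QR(3)[OF f i] by (simp add: distrib_right)
      also have "ennreal (1 - e) + ennreal e = 1"
        using e by (simp add: ennreal_plus[symmetric] del: ennreal_plus)
      finally show "(\<integral>\<^sup>+x. f (x i) \<partial>T) = (\<integral>\<^sup>+x. f x \<partial>\<rho>)" by simp
    qed
  next
    fix \<psi> :: "real \<Rightarrow> ennreal" and A
    assume \<psi>: "\<psi> \<in> borel_measurable borel" and A: "\<And>t. \<beta> \<le> t \<Longrightarrow> \<psi> t \<le> A"
    note ps = pairsum_measurable[OF \<psi>, of N]
    have Q': "(\<integral>\<^sup>+x. pairsum \<psi> N x \<partial>?Q) = ennreal e * (\<integral>\<^sup>+x. pairsum \<psi> N x \<partial>Q)"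
      using ps by (simp add: nn_integral_scale_measure mQ)
    have "(\<integral>\<^sup>+x. pairsum \<psi> N x \<partial>T) \<le> ennreal (1 - e) * (\<integral>\<^sup>+x. pairsum \<psi> N x \<partial>P)
        + of_nat N ^ 3 * A * (ennreal e * emeasure R (space R)) + ennreal e * (\<integral>\<^sup>+x. pairsum \<psi> N x \<partial>Q)"
      using T'_cost[OF \<psi> A] unfolding T_int[OF ps] Q'
      by (intro add_right_mono) (simp add: space_scale_measure)
    also have "\<dots> = ennreal (1 - e) * (\<integral>\<^sup>+x. pairsum \<psi> N x \<partial>P)
        + ennreal e * ((\<integral>\<^sup>+x. pairsum \<psi> N x \<partial>Q) + of_nat N ^ 3 * A * emeasure R (space R))"
      by (simp add: distrib_left ac_simps)
    finally show "(\<integral>\<^sup>+x. pairsum \<psi> N x \<partial>T) \<le> ennreal (1 - l / N) * (\<integral>\<^sup>+x. pairsum \<psi> N x \<partial>P)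
        + ennreal (l / N) * ((\<integral>\<^sup>+x. pairsum \<psi> N x \<partial>Q) + of_nat N ^ 3 * A * emeasure R (space R))"
      by (simp add: e_def)
  qed
qed

text \<open>The product of the normalised measures, rescaled to mass \<open>d\<close>. Normalising
  fails for \<open>d = 0\<close>, where the null measure serves. Nothing is claimed about costs,
  since couplings built here for the estimate are exchanged away.\<close>

lemma ex_coupling:
  assumes r: "\<And>i. i < N \<Longrightarrow> sets (r i) = sets borel"
    and d: "\<And>i. i < N \<Longrightarrow> emeasure (r i) (space (r i)) = ennreal d" and "d \<ge> 0"
  obtains R where "sets R = sets (config N)"
    and "\<And>f i. f \<in> borel_measurable borel \<Longrightarrow> i < N \<Longrightarrow>
      (\<integral>\<^sup>+x. f (x i) \<partial>R) = (\<integral>\<^sup>+x. f x \<partial>r i)"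
proof (cases "d = 0")
  case True
  have "(\<integral>\<^sup>+x. f x \<partial>r i) = 0" if "f \<in> borel_measurable borel" "i < N" for f i
  proof -
    have "f \<in> borel_measurable (r i)" using that r by (simp add: measurable_cong_sets[OF r refl])
    moreover have "AE x in r i. f x = 0"
      using d[OF that(2)] True by (intro AE_I[of _ _ "space (r i)"]) auto
    ultimately show ?thesis by (simp add: nn_integral_0_iff_AE)
  qed
  then show ?thesis by (intro that[of "null_measure (config N)"]) auto
next
  case False
  then have dpos: "d > 0" using \<open>d \<ge> 0\<close> by simp
  \<comment> \<open>The locale for product measures wants a probability measure at every index, so a
    point mass fills the indices outside \<open>{..<N}\<close>.\<close>
  define q where "q i = (if i < N then scale_measure (ennreal (1 / d)) (r i) else return borel 0)" for i
  have q: "prob_space (q i)" for i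
    unfolding q_def using d dpos
    by (auto intro!: prob_spaceI simp: space_scale_measure ennreal_mult[symmetric] prob_space_return
        emeasure_return)
  interpret product_prob_space q "{..<N}"
    using q by (intro product_prob_spaceI)
  have sq: "sets (q i) = sets borel" for i by (auto simp: q_def r)
  define R where "R = scale_measure (ennreal d) (PiM {..<N} q)"
  have sP: "sets (PiM {..<N} q) = sets (config N)" by (intro sets_PiM_cong) (auto simp: sq)
  show thesis
  proof (rule that)
    show "sets R = sets (config N)" by (simp add: R_def sP)
  next
    fix f :: "R3 \<Rightarrow> ennreal" and i assume f: "f \<in> borel_measurable borel" and i: "i < N"
    have fi: "(\<lambda>x. f (x i)) \<in> borel_measurable (PiM {..<N} q)"
      using coord_measurable[OF f i] by (simp add: measurable_cong_sets[OF sP refl])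
    have fq: "f \<in> borel_measurable (q i)" using f by (simp add: measurable_cong_sets[OF sq refl])
    have fr: "f \<in> borel_measurable (r i)" using f by (simp add: measurable_cong_sets[OF r[OF i] refl])
    have "(\<integral>\<^sup>+x. f (x i) \<partial>R) = ennreal d * (\<integral>\<^sup>+x. f (x i) \<partial>PiM {..<N} q)"
      unfolding R_def using fi by (rule nn_integral_scale_measure)
    also have "(\<integral>\<^sup>+x. f (x i) \<partial>PiM {..<N} q) = (\<integral>\<^sup>+x. f x \<partial>distr (PiM {..<N} q) (q i) (\<lambda>x. x i))"
      using fq i by (subst nn_integral_distr) auto
    also have "distr (PiM {..<N} q) (q i) (\<lambda>x. x i) = q i" using i by (intro PiM_component) auto
    also have "(\<integral>\<^sup>+x. f x \<partial>q i) = ennreal (1 / d) * (\<integral>\<^sup>+x. f x \<partial>r i)"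
      unfolding q_def using i fr by (simp add: nn_integral_scale_measure)
    also have "ennreal d * (ennreal (1 / d) * (\<integral>\<^sup>+x. f x \<partial>r i)) = (\<integral>\<^sup>+x. f x \<partial>r i)"
      using dpos by (simp add: mult.assoc[symmetric] ennreal_mult[symmetric])
    finally show "(\<integral>\<^sup>+x. f (x i) \<partial>R) = (\<integral>\<^sup>+x. f x \<partial>r i)" .
  qed
qed

section \<open>Plans of finite cost\<close>

lemma nn_integral_density_indicator_split:
  assumes "G \<in> sets M" "f \<in> borel_measurable M"
  shows "(\<integral>\<^sup>+x. f x \<partial>density M (indicator G)) + (\<integral>\<^sup>+x. f x \<partial>density M (indicator (space M - G)))
    = (\<integral>\<^sup>+x. f x \<partial>M)"
proof -
  have "(\<integral>\<^sup>+x. f x \<partial>density M (indicator G)) + (\<integral>\<^sup>+x. f x \<partial>density M (indicator (space M - G)))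
      = (\<integral>\<^sup>+x. indicator G x * f x + indicator (space M - G) x * f x \<partial>M)"
    using assms by (simp add: nn_integral_density nn_integral_add)
  also have "\<dots> = (\<integral>\<^sup>+x. f x \<partial>M)"
    by (intro nn_integral_cong) (auto simp: indicator_def)
  finally show ?thesis .
qed

lemma pairsum_eq_0D: "pairsum \<psi> N x = 0 \<Longrightarrow> i < j \<Longrightarrow> j < N \<Longrightarrow> \<psi> (norm (x i - x j)) = 0"
  unfolding pairsum_def by (auto simp: sum_eq_0_iff)

text \<open>The sum counts close pairs, so its integral dominates the probability that a close pair
  exists.\<close>

lemma pairsum_overlap_ge_1:
  assumes "pairsum (indicator {..<\<beta>}) N x \<noteq> 0"
  shows "1 \<le> pairsum (indicator {..<\<beta>}) N x"
proof -
  let ?f = "\<lambda>i j. indicator {..<\<beta>} (norm (x i - x j)) :: ennreal"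
  obtain i j where ij: "i < j" "j < N" "?f i j \<noteq> 0"
    using assms unfolding pairsum_def by (auto simp: sum_eq_0_iff)
  have "1 = ?f i j" using ij by (auto simp: indicator_def split: if_splits)
  also have "\<dots> \<le> (\<Sum>i<j. ?f i j)" using ij by (intro member_le_sum) auto
  also have "\<dots> \<le> (\<Sum>j<N. \<Sum>i<j. ?f i j)"
    using ij by (intro member_le_sum[of j "{..<N}" "\<lambda>j. \<Sum>i<j. ?f i j"]) auto
  finally show ?thesis by (simp add: pairsum_def)
qed

lemma ex_transport_plan:
  assumes \<rho>: "borel_prob \<rho>" and "N > 0"
  shows "\<exists>P. P \<in> transport_plans N \<rho>"
proof -
  interpret \<rho>: prob_space \<rho> using \<rho> by (simp add: borel_prob_def)
  obtain P where "sets P = sets (config N)"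
    "\<And>f i. f \<in> borel_measurable borel \<Longrightarrow> i < N \<Longrightarrow> (\<integral>\<^sup>+x. f (x i) \<partial>P) = (\<integral>\<^sup>+x. f x \<partial>\<rho>)"
    by (rule ex_coupling[of N "\<lambda>_. \<rho>" 1]) (use \<rho> \<rho>.emeasure_space_1 in \<open>auto simp: borel_prob_def\<close>)
  then show ?thesis using transport_plansI[OF \<rho> _ \<open>N > 0\<close>] by blast
qed

text \<open>Starting from any plan, iterate \<open>ex_improved_plan\<close> with \<open>Q\<close>
  the part free of close pairs and \<open>R\<close> the rest. The interaction vanishes from
  \<open>\<beta>\<close> on, so the exchange adds no close pairs and each round leaves at most the
  factor \<open>1 - l / N\<close>.\<close>

lemma ex_plan_small_overlap:
  assumes \<rho>: "borel_prob \<rho>" and "N > 0"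
    and l: "l = 1 - 2 * (real N - 1)^2 * concentration \<rho> \<beta>" "l > 0"
  shows "\<exists>P\<in>transport_plans N \<rho>.
    (\<integral>\<^sup>+x. pairsum (indicator {..<\<beta>}) N x \<partial>P) \<le> ennreal ((1 - l / N) ^ n * real N ^ 2)"
proof (induction n)
  case 0
  obtain P where P: "P \<in> transport_plans N \<rho>" using ex_transport_plan[OF \<rho> \<open>N > 0\<close>] by blast
  then interpret prob_space P by (simp add: transport_plans_def)
  have "(\<integral>\<^sup>+x. pairsum (indicator {..<\<beta>}) N x \<partial>P) \<le> (\<integral>\<^sup>+x. of_nat N ^ 2 * 1 \<partial>P)"
    by (intro nn_integral_mono pairsum_le_const) (auto simp: indicator_def)
  also have "\<dots> = ennreal (real N ^ 2)"
    by (simp add: emeasure_space_1 ennreal_of_nat_eq_real_of_nat ennreal_power)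
  finally show ?case using P by auto
next
  case (Suc n)
  let ?\<psi> = "indicator {..<\<beta>} :: real \<Rightarrow> ennreal"
  obtain P where P: "P \<in> transport_plans N \<rho>"
    and P_le: "(\<integral>\<^sup>+x. pairsum ?\<psi> N x \<partial>P) \<le> ennreal ((1 - l / N) ^ n * real N ^ 2)"
    using Suc by blast
  have s: "sets P = sets (config N)" using P by (simp add: transport_plans_def)
  note mP = measurable_cong_sets[OF s refl]
  have \<psi>: "?\<psi> \<in> borel_measurable borel" by simp
  note ps = pairsum_measurable[OF \<psi>, of N]
  define G where "G = {x\<in>space P. pairsum ?\<psi> N x = 0}"
  have G: "G \<in> sets P" unfolding G_def using ps by (auto simp: mP[symmetric])
  let ?Q = "density P (indicator G)" and ?R = "density P (indicator (space P - G))"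
  obtain T where T: "T \<in> transport_plans N \<rho>"
    and T_le: "\<And>\<psi> A. \<psi> \<in> borel_measurable borel \<Longrightarrow> (\<And>t. \<beta> \<le> t \<Longrightarrow> \<psi> t \<le> A) \<Longrightarrow>
      (\<integral>\<^sup>+x. pairsum \<psi> N x \<partial>T) \<le> ennreal (1 - l / N) * (\<integral>\<^sup>+x. pairsum \<psi> N x \<partial>P)
        + ennreal (l / N) * ((\<integral>\<^sup>+x. pairsum \<psi> N x \<partial>?Q) + of_nat N ^ 3 * A * emeasure ?R (space ?R))"
  proof (rule ex_improved_plan[OF \<rho> \<open>N > 0\<close> l P, of ?Q ?R])
    fix f :: "R3 \<Rightarrow> ennreal" and i assume f: "f \<in> borel_measurable borel" and i: "i < N"
    show "(\<integral>\<^sup>+x. f (x i) \<partial>?Q) + (\<integral>\<^sup>+x. f (x i) \<partial>?R) = (\<integral>\<^sup>+x. f x \<partial>\<rho>)"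
      using coord_measurable[OF f i] transport_plans_marginal[OF P f i]
      by (subst nn_integral_density_indicator_split[OF G]) (auto simp: mP)
  qed (use s in auto)
  have "(\<integral>\<^sup>+x. pairsum ?\<psi> N x \<partial>?Q) = (\<integral>\<^sup>+x. indicator G x * pairsum ?\<psi> N x \<partial>P)"
    using G ps by (intro nn_integral_density borel_measurable_indicator) (auto simp: mP)
  also have "\<dots> = (\<integral>\<^sup>+x. 0 \<partial>P)" by (intro nn_integral_cong) (auto simp: G_def indicator_def)
  finally have Q0: "(\<integral>\<^sup>+x. pairsum ?\<psi> N x \<partial>?Q) = 0" by simp
  have l1: "l / N \<le> 1"
    using concentration_nonneg[OF \<rho>, of \<beta>] l \<open>N > 0\<close> by (simp add: field_simps)
      (smt (verit) mult_nonneg_nonneg zero_le_power2 of_nat_0_less_iff of_nat_le_iff One_nat_def Suc_leI of_nat_1)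
  \<comment> \<open>The bound is instantiated with \<open>A = 0\<close>, and the kept part
    contributes 0 by \<open>Q0\<close>.\<close>
  have "(\<integral>\<^sup>+x. pairsum ?\<psi> N x \<partial>T) \<le> ennreal (1 - l / N) * (\<integral>\<^sup>+x. pairsum ?\<psi> N x \<partial>P)"
    using T_le[OF \<psi>, of 0] Q0 by (simp add: indicator_def)
  also have "\<dots> \<le> ennreal (1 - l / N) * ennreal ((1 - l / N) ^ n * real N ^ 2)"
    by (intro mult_left_mono P_le) auto
  also have "\<dots> = ennreal ((1 - l / N) ^ Suc n * real N ^ 2)"
    using l1 by (subst ennreal_mult[symmetric]) (auto simp: mult.assoc)
  finally show ?case using T by blast
qed

text \<open>Improving \<open>P\<close> as a whole would leave a multiple of its possibly infinite
  cost. Instead the rare bad part is exchanged against the good part alone, on which every pair is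
  at distance at least \<open>\<beta>\<close> and the interaction is bounded.\<close>

lemma ex_finite_cost_plan:
  assumes \<rho>: "borel_prob \<rho>" and "N > 0"
    and l: "l = 1 - 2 * (real N - 1)^2 * concentration \<rho> \<beta>" "l > 0"
    and \<psi>: "\<psi> \<in> borel_measurable borel" and A: "\<And>t. \<beta> \<le> t \<Longrightarrow> \<psi> t \<le> ennreal A"
  shows "\<exists>P\<in>transport_plans N \<rho>. (\<integral>\<^sup>+x. pairsum \<psi> N x \<partial>P) < \<infinity>"
proof -
  let ?\<psi> = "indicator {..<\<beta>} :: real \<Rightarrow> ennreal"
  define \<kappa> where "\<kappa> = concentration \<rho> \<beta>"
  have \<kappa>: "\<kappa> \<ge> 0" by (simp add: \<kappa>_def concentration_nonneg \<rho>)
  have l1: "l \<le> 1" using l \<kappa> by (simp add: \<kappa>_def)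
  have "(\<lambda>n. (1 - l / N) ^ n * real N ^ 2) \<longlonglongrightarrow> 0 * real N ^ 2"
    using l(2) l1 \<open>N > 0\<close>
    by (intro tendsto_intros LIMSEQ_power_zero) (auto simp: abs_if field_simps)
  \<comment> \<open>The threshold makes the bad mass \<open>1 - p\<close> at most
    \<open>l / (2 * N)\<close>. This gives \<open>p > 0\<close>, then \<open>1 - p < l\<close> so
    that \<open>l'\<close> is positive, and finally the mass condition \<open>R_le\<close>.\<close>
  then have "eventually (\<lambda>n. (1 - l / N) ^ n * real N ^ 2 < l / (2 * N)) sequentially"
    by (rule order_tendstoD(2)) (use l(2) \<open>N > 0\<close> in auto)
  then obtain n where n: "(1 - l / N) ^ n * real N ^ 2 < l / (2 * N)"
    by (auto simp: eventually_sequentially)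
  obtain P where P: "P \<in> transport_plans N \<rho>"
    and P_le: "(\<integral>\<^sup>+x. pairsum ?\<psi> N x \<partial>P) \<le> ennreal ((1 - l / N) ^ n * real N ^ 2)"
    using ex_plan_small_overlap[OF \<rho> \<open>N > 0\<close> l] by blast
  interpret P: prob_space P using P by (simp add: transport_plans_def)
  have s: "sets P = sets (config N)" using P by (simp add: transport_plans_def)
  note mP = measurable_cong_sets[OF s refl]
  note ps0 = pairsum_measurable[of ?\<psi>, of N] and ps = pairsum_measurable[OF \<psi>, of N]
  define G where "G = {x\<in>space P. pairsum ?\<psi> N x = 0}"
  have G: "G \<in> sets P" unfolding G_def using ps0 by (auto simp: mP[symmetric])
  let ?Q = "density P (indicator G)" and ?R = "density P (indicator (space P - G))"
  define p where "p = measure P G"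
  have "emeasure P (space P - G) = (\<integral>\<^sup>+x. indicator (space P - G) x \<partial>P)" using G by simp
  also have "\<dots> \<le> (\<integral>\<^sup>+x. pairsum ?\<psi> N x \<partial>P)"
  proof (rule nn_integral_mono)
    fix x
    show "indicator (space P - G) x \<le> pairsum ?\<psi> N x"
      using pairsum_overlap_ge_1[of \<beta> N x] by (cases "x \<in> space P - G") (auto simp: G_def)
  qed
  also note P_le
  finally have "emeasure P (space P - G) \<le> ennreal (l / (2 * N))"
    using n by (auto elim!: order_trans intro!: ennreal_leI)
  then have "measure P (space P - G) \<le> l / (2 * N)"
    using l(2) by (simp add: P.emeasure_eq_measure ennreal_le_iff)
  then have p: "1 - p \<le> l / (2 * N)" using G by (simp add: P.prob_compl p_def)
  have "l / (2 * N) \<le> l / 2" using l(2) \<open>N > 0\<close> by (simp add: field_simps)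
  then have p0: "p > 0" and p1: "1 - p < l" using p l1 l(2) by auto
  have Qi: "(\<integral>\<^sup>+x. f x \<partial>?Q) = (\<integral>\<^sup>+x. indicator G x * f x \<partial>P)" if "f \<in> borel_measurable (config N)" for f
    using G that by (intro nn_integral_density borel_measurable_indicator) (auto simp: mP)
  have Q_space: "emeasure ?Q (space ?Q) = ennreal p"
    using G by (simp add: emeasure_density p_def P.emeasure_eq_measure)
  have R_space: "emeasure ?R (space ?R) = ennreal (1 - p)"
    using G P.prob_compl[OF G]
    by (simp add: emeasure_density p_def P.emeasure_eq_measure flip: indicator_inter_arith)
  let ?P = "scale_measure (ennreal (1 / p)) ?Q"
  have P': "prob_space ?P"
    using Q_space p0 by (intro prob_spaceI) (simp add: space_scale_measure ennreal_mult[symmetric])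
  have sP': "sets ?P = sets (config N)" by (simp add: s)
  have fR: "finite_measure ?R" by (rule finite_measureI) (subst R_space, simp)
  \<comment> \<open>Conditioning on the good set weakens the concentration bound from
    \<open>\<kappa>\<close> to \<open>\<kappa> / p\<close>; the sampling constant changes
    accordingly.\<close>
  define l' where "l' = 1 - 2 * (real N - 1)^2 * (\<kappa> / p)"
  have pl: "p * l' = p - (1 - l)" using p0 by (simp add: l'_def l \<kappa>_def field_simps)
  have l': "l' > 0" using pl p1 p0 by (smt (verit) mult_nonneg_nonpos)
  have conc: "emeasure ?P {x\<in>space ?P. dist z (x i) < \<beta>} \<le> ennreal (\<kappa> / p)" if i: "i < N" for i z
  proof -
    let ?B = "{x\<in>space P. dist z (x i) < \<beta>}"
    have "?B \<in> sets P"
      using coord_measurable[of "\<lambda>x. x" borel i N] i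
      by (auto simp: mP[symmetric])
    then have "emeasure ?Q ?B \<le> emeasure P ?B"
      using G by (subst emeasure_density)
        (auto intro!: nn_integral_mono simp: indicator_def simp flip: nn_integral_indicator)
    also have "\<dots> \<le> ennreal \<kappa>" unfolding \<kappa>_def by (rule transport_plans_close_le[OF \<rho> P i])
    finally have "ennreal (1 / p) * emeasure ?Q ?B \<le> ennreal (1 / p) * ennreal \<kappa>"
      by (intro mult_left_mono) auto
    then show ?thesis
      using p0 \<kappa> by (simp add: space_scale_measure ennreal_mult[symmetric])
  qed
  \<comment> \<open>Since \<open>p * l' = l - (1 - p)\<close>, this amounts to
    \<open>(1 - p) * N \<le> l\<close>.\<close>
  have R_le: "measure ?R (space ?R) * (real N - 1) \<le> p * l'"
  proof -
    have "l / real (2 * N) \<le> l / N" using l(2) \<open>N > 0\<close> by (simp add: field_simps)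
    with p have "1 - p \<le> l / N" by linarith
    then have "(1 - p) * real N \<le> l" using \<open>N > 0\<close> by (simp add: field_simps)
    moreover have mR: "measure ?R (space ?R) = 1 - p"
      unfolding measure_def R_space by (simp add: p_def)
    ultimately show ?thesis unfolding pl mR by (simp add: algebra_simps)
  qed
  obtain T where T: "sets T = sets (config N)"
    and T_marg: "\<And>f i. f \<in> borel_measurable borel \<Longrightarrow> i < N \<Longrightarrow>
      (\<integral>\<^sup>+x. f (x i) \<partial>T) = ennreal p * (\<integral>\<^sup>+x. f (x i) \<partial>?P) + (\<integral>\<^sup>+x. f (x i) \<partial>?R)"
    and T_cost: "\<And>\<psi> A. \<psi> \<in> borel_measurable borel \<Longrightarrow> (\<And>t. \<beta> \<le> t \<Longrightarrow> \<psi> t \<le> A) \<Longrightarrow>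
      (\<integral>\<^sup>+x. pairsum \<psi> N x \<partial>T)
        \<le> ennreal p * (\<integral>\<^sup>+x. pairsum \<psi> N x \<partial>?P) + of_nat N ^ 3 * A * emeasure ?R (space ?R)"
    by (rule exchange[OF P' sP' conc _ \<open>N > 0\<close> l'_def l' fR _ _ R_le])
      (assumption | use s p0 \<kappa> in simp | blast)+
  have P'i: "ennreal p * (\<integral>\<^sup>+x. f x \<partial>?P) = (\<integral>\<^sup>+x. f x \<partial>?Q)" if "f \<in> borel_measurable (config N)" for f
    using that p0
    by (simp add: nn_integral_scale_measure mP mult.assoc[symmetric] ennreal_mult[symmetric])
  have "T \<in> transport_plans N \<rho>"
  proof (rule transport_plansI[OF \<rho> T \<open>N > 0\<close>])
    fix f :: "R3 \<Rightarrow> ennreal" and i assume f: "f \<in> borel_measurable borel" and i: "i < N"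
    show "(\<integral>\<^sup>+x. f (x i) \<partial>T) = (\<integral>\<^sup>+x. f x \<partial>\<rho>)"
      using coord_measurable[OF f i] transport_plans_marginal[OF P f i]
        nn_integral_density_indicator_split[OF G, of "\<lambda>x. f (x i)"]
      by (simp add: T_marg[OF f i] P'i mP)
  qed
  moreover have "(\<integral>\<^sup>+x. pairsum \<psi> N x \<partial>T) < \<infinity>"
  proof -
    have "(\<integral>\<^sup>+x. pairsum \<psi> N x \<partial>?Q) = (\<integral>\<^sup>+x. indicator G x * pairsum \<psi> N x \<partial>P)"
      by (rule Qi[OF ps])
    also have "\<dots> \<le> (\<integral>\<^sup>+x. of_nat N ^ 2 * ennreal A \<partial>P)"
    proof (rule nn_integral_mono)
      fix x
      have "pairsum \<psi> N x \<le> of_nat N ^ 2 * ennreal A" if "x \<in> G"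
      proof (rule pairsum_le_const)
        fix i j assume "i < j" "j < N"
        then have "?\<psi> (norm (x i - x j)) = 0" using that by (intro pairsum_eq_0D) (auto simp: G_def)
        then show "\<psi> (norm (x i - x j)) \<le> ennreal A"
          by (intro A) (auto simp: indicator_def split: if_splits)
      qed
      then show "indicator G x * pairsum \<psi> N x \<le> of_nat N ^ 2 * ennreal A" by (auto simp: indicator_def)
    qed
    also have "\<dots> < \<infinity>"
      by (simp add: P.emeasure_space_1 ennreal_mult_less_top ennreal_of_nat_eq_real_of_nat ennreal_power)
    finally have "(\<integral>\<^sup>+x. pairsum \<psi> N x \<partial>?Q) < \<infinity>" .
    moreover have "of_nat N ^ 3 * ennreal A * emeasure ?R (space ?R) < \<infinity>"
      unfolding R_space by (simp add: ennreal_mult_less_top ennreal_of_nat_eq_real_of_nat ennreal_power)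
    ultimately show ?thesis
      using T_cost[OF \<psi> A] unfolding P'i[OF ps] by (auto intro: le_less_trans)
  qed
  ultimately show ?thesis by blast
qed

section \<open>Comparison of two marginals\<close>

text \<open>The measure with density \<open>h\<close> with respect to \<open>\<rho>\<^sub>0\<close>
  is the common part of both: it is \<open>\<rho>\<^sub>1\<close> on \<open>Z\<close>, where
  \<open>\<rho>\<^sub>1\<close> is the smaller one, and \<open>\<rho>\<^sub>0\<close> off
  \<open>Z\<close>. The number \<open>m\<close> is the mass of \<open>\<rho>\<^sub>0\<close> left
  over.\<close>

lemma ex_common_density:
  assumes \<rho>: "borel_prob \<rho>\<^sub>0" "borel_prob \<rho>\<^sub>1"
  obtains h m where "h \<in> borel_measurable borel" "\<And>x. h x \<le> (1 :: ennreal)" "m \<ge> 0"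
    and "\<And>B. B \<in> sets borel \<Longrightarrow> (\<integral>\<^sup>+x. h x * indicator B x \<partial>\<rho>\<^sub>0) \<le> emeasure \<rho>\<^sub>1 B"
    and "(\<integral>\<^sup>+x. 1 - h x \<partial>\<rho>\<^sub>0) = ennreal m"
    and "ennreal (2 * m) \<le> L1_dist \<rho>\<^sub>0 \<rho>\<^sub>1"
proof -
  interpret \<rho>0: prob_space \<rho>\<^sub>0 using \<rho> by (simp add: borel_prob_def)
  interpret \<rho>1: prob_space \<rho>\<^sub>1 using \<rho> by (simp add: borel_prob_def)
  have s[simp, measurable_cong]: "sets \<rho>\<^sub>0 = sets borel" "sets \<rho>\<^sub>1 = sets borel"
    using \<rho> by (auto simp: borel_prob_def)
  have sp[simp]: "space \<rho>\<^sub>0 = UNIV" "space \<rho>\<^sub>1 = UNIV"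
    using sets_eq_imp_space_eq[OF s(1)] sets_eq_imp_space_eq[OF s(2)] by auto
  obtain Y where Y[measurable]: "Y \<in> sets borel"
    and Y_le: "\<And>X. X \<in> sets borel \<Longrightarrow> X \<subseteq> Y \<Longrightarrow> emeasure \<rho>\<^sub>1 X \<le> emeasure \<rho>\<^sub>0 X"
    and Y_ge: "\<And>X. X \<in> sets borel \<Longrightarrow> X \<inter> Y = {} \<Longrightarrow> emeasure \<rho>\<^sub>0 X \<le> emeasure \<rho>\<^sub>1 X"
    using finite_unsigned_Hahn_decomposition[OF \<rho>0.finite_measure_axioms \<rho>1.finite_measure_axioms]
    by auto
  \<comment> \<open>In general \<open>\<rho>\<^sub>1\<close> has no density with respect to
    \<open>\<rho>\<^sub>0\<close>, but its restriction to the Hahn set \<open>Y\<close> is dominated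
    by \<open>\<rho>\<^sub>0\<close> and has one.\<close>
  have "absolutely_continuous \<rho>\<^sub>0 (density \<rho>\<^sub>1 (indicator Y))"
    unfolding absolutely_continuous_def
  proof (intro subsetI null_setsI)
    fix X assume X: "X \<in> null_sets \<rho>\<^sub>0"
    then have [measurable]: "X \<in> sets borel" by auto
    have "emeasure (density \<rho>\<^sub>1 (indicator Y)) X = emeasure \<rho>\<^sub>1 (Y \<inter> X)"
      by (simp add: emeasure_density flip: indicator_inter_arith)
    also have "\<dots> \<le> emeasure \<rho>\<^sub>0 (Y \<inter> X)" by (intro Y_le) auto
    also have "\<dots> \<le> emeasure \<rho>\<^sub>0 X" by (intro emeasure_mono) auto
    finally show "emeasure (density \<rho>\<^sub>1 (indicator Y)) X = 0" using null_setsD1[OF X] by simp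
  qed auto
  then obtain g where g[measurable]: "g \<in> borel_measurable borel"
    and g_eq: "density \<rho>\<^sub>0 g = density \<rho>\<^sub>1 (indicator Y)"
    using \<rho>0.Radon_Nikodym[of "density \<rho>\<^sub>1 (indicator Y)"]
    by (auto simp: measurable_cong_sets[OF s(1) refl])
  have gX: "(\<integral>\<^sup>+x. g x * indicator X x \<partial>\<rho>\<^sub>0) = emeasure \<rho>\<^sub>1 X" if "X \<in> sets borel" "X \<subseteq> Y" for X
  proof -
    have "(\<integral>\<^sup>+x. g x * indicator X x \<partial>\<rho>\<^sub>0) = emeasure (density \<rho>\<^sub>1 (indicator Y)) X"
      using that by (simp add: emeasure_density flip: g_eq)
    also have "\<dots> = emeasure \<rho>\<^sub>1 (Y \<inter> X)"
      using that by (simp add: emeasure_density flip: indicator_inter_arith)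
    also have "Y \<inter> X = X" using that by auto
    finally show ?thesis .
  qed
  \<comment> \<open>Discarding the part of \<open>Y\<close> where \<open>g > 1\<close> (which is null) makes \<open>h \<le> 1\<close> hold everywhere.\<close>
  define Z where "Z = {x\<in>Y. g x \<le> 1}"
  have Z[measurable]: "Z \<in> sets borel" unfolding Z_def by measurable
  have Z_ge: "emeasure \<rho>\<^sub>0 X \<le> emeasure \<rho>\<^sub>1 X" if X[measurable]: "X \<in> sets borel" and "X \<inter> Z = {}" for X
  proof -
    have *: "emeasure M X = emeasure M (X \<inter> Y) + emeasure M (X - Y)" if "sets M = sets borel" for M
      using that by (subst plus_emeasure) (auto simp: Int_Diff_Un)
    have "emeasure \<rho>\<^sub>0 (X \<inter> Y) = (\<integral>\<^sup>+x. indicator (X \<inter> Y) x \<partial>\<rho>\<^sub>0)" by simp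
    also have "\<dots> \<le> (\<integral>\<^sup>+x. g x * indicator (X \<inter> Y) x \<partial>\<rho>\<^sub>0)"
      using that by (intro nn_integral_mono) (auto simp: indicator_def Z_def not_le less_imp_le)
    also have "\<dots> = emeasure \<rho>\<^sub>1 (X \<inter> Y)" by (intro gX) auto
    finally show ?thesis
      unfolding *[OF s(1)] *[OF s(2)] by (intro add_mono) (auto intro!: Y_ge)
  qed
  define h where "h x = (if x \<in> Z then g x else 1)" for x
  have h[measurable]: "h \<in> borel_measurable borel" unfolding h_def by measurable
  have hB: "(\<integral>\<^sup>+x. h x * indicator B x \<partial>\<rho>\<^sub>0) = emeasure \<rho>\<^sub>1 (B \<inter> Z) + emeasure \<rho>\<^sub>0 (B - Z)"
    if [measurable]: "B \<in> sets borel" for B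
  proof -
    have "(\<integral>\<^sup>+x. h x * indicator B x \<partial>\<rho>\<^sub>0)
        = (\<integral>\<^sup>+x. g x * indicator (B \<inter> Z) x + indicator (B - Z) x \<partial>\<rho>\<^sub>0)"
      by (intro nn_integral_cong) (auto simp: h_def indicator_def)
    also have "\<dots> = (\<integral>\<^sup>+x. g x * indicator (B \<inter> Z) x \<partial>\<rho>\<^sub>0) + emeasure \<rho>\<^sub>0 (B - Z)"
      by (subst nn_integral_add) auto
    also have "(\<integral>\<^sup>+x. g x * indicator (B \<inter> Z) x \<partial>\<rho>\<^sub>0) = emeasure \<rho>\<^sub>1 (B \<inter> Z)"
      by (intro gX) (auto simp: Z_def)
    finally show ?thesis .
  qed
  define m where "m = measure \<rho>\<^sub>0 Z - measure \<rho>\<^sub>1 Z"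
  have m: "m \<ge> 0"
    using Y_le[of Z] by (simp add: m_def Z_def \<rho>0.emeasure_eq_measure \<rho>1.emeasure_eq_measure)
  have m1: "m \<le> 1"
    unfolding m_def using \<rho>0.prob_le_1[of Z] measure_nonneg[of \<rho>\<^sub>1 Z] by linarith
  have h1: "h x \<le> 1" for x by (auto simp: h_def Z_def)
  show thesis
  proof (rule that[OF h h1 m])
    fix B :: "R3 set" assume [measurable]: "B \<in> sets borel"
    have "(\<integral>\<^sup>+x. h x * indicator B x \<partial>\<rho>\<^sub>0) \<le> emeasure \<rho>\<^sub>1 (B \<inter> Z) + emeasure \<rho>\<^sub>1 (B - Z)"
      unfolding hB[OF \<open>B \<in> sets borel\<close>] by (intro add_left_mono Z_ge) auto
    also have "\<dots> = emeasure \<rho>\<^sub>1 B"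
      by (subst plus_emeasure) (auto simp: Int_Diff_Un)
    finally show "(\<integral>\<^sup>+x. h x * indicator B x \<partial>\<rho>\<^sub>0) \<le> emeasure \<rho>\<^sub>1 B" .
  next
    have hint: "(\<integral>\<^sup>+x. h x \<partial>\<rho>\<^sub>0) = ennreal (1 - m)"
    proof -
      have "1 - m = measure \<rho>\<^sub>1 Z + measure \<rho>\<^sub>0 (UNIV - Z)"
        using \<rho>0.prob_compl[of Z] by (simp add: m_def)
      then show ?thesis
        using hB[of UNIV] by (simp add: \<rho>0.emeasure_eq_measure \<rho>1.emeasure_eq_measure)
    qed
    have "(\<integral>\<^sup>+x. 1 - h x \<partial>\<rho>\<^sub>0) = (\<integral>\<^sup>+x. 1 \<partial>\<rho>\<^sub>0) - (\<integral>\<^sup>+x. h x \<partial>\<rho>\<^sub>0)"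
      using h1 by (intro nn_integral_diff) (simp_all add: hint)
    also have "\<dots> = ennreal 1 - ennreal (1 - m)"
      using \<rho>0.emeasure_space_1 by (simp add: hint)
    also have "\<dots> = ennreal m"
      using m1 by (subst ennreal_minus) auto
    finally show "(\<integral>\<^sup>+x. 1 - h x \<partial>\<rho>\<^sub>0) = ennreal m" .
  next
    \<comment> \<open>The partition into \<open>Z\<close> and its complement, padded with empty
      sets. Both total masses are 1, so each of the two blocks contributes \<open>m\<close>.\<close>
    define A :: "nat \<Rightarrow> R3 set" where "A n = (if n = 0 then Z else if n = 1 then - Z else {})" for n
    have "(\<Sum>n. ennreal \<bar>measure \<rho>\<^sub>0 (A n) - measure \<rho>\<^sub>1 (A n)\<bar>)
        = (\<Sum>n<2. ennreal \<bar>measure \<rho>\<^sub>0 (A n) - measure \<rho>\<^sub>1 (A n)\<bar>)"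
      by (intro suminf_finite) (auto simp: A_def)
    also have "\<dots> = ennreal (2 * m)"
      using m \<rho>0.prob_compl[of Z] \<rho>1.prob_compl[of Z]
      by (simp add: A_def numeral_2_eq_2 Compl_eq_Diff_UNIV m_def ennreal_plus[symmetric] del: ennreal_plus)
    finally have "ennreal (2 * m) = (\<Sum>n. ennreal \<bar>measure \<rho>\<^sub>0 (A n) - measure \<rho>\<^sub>1 (A n)\<bar>)" ..
    also have "\<dots> \<le> L1_dist \<rho>\<^sub>0 \<rho>\<^sub>1"
      unfolding L1_dist_def total_variation_def
      by (rule SUP_upper) (auto simp: A_def disjoint_family_on_def split: if_splits)
    finally show "ennreal (2 * m) \<le> L1_dist \<rho>\<^sub>0 \<rho>\<^sub>1" .
  qed
qed

text \<open>Thinning \<open>P\<^sub>0\<close> by \<open>w\<close> gives a part \<open>Q\<close> with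
  marginals below \<open>\<rho>\<^sub>1\<close> and mass defect at most \<open>N m\<close>. The
  missing marginals are coupled arbitrarily into \<open>R\<close>, and \<open>R\<close> is then
  exchanged away against \<open>P\<^sub>1\<close>. The factor \<open>N ^ 4\<close> is
  \<open>N ^ 3\<close> from the exchange times \<open>N\<close> from the defect.\<close>

lemma plan_comparison:
  assumes \<rho>: "borel_prob \<rho>\<^sub>0" "borel_prob \<rho>\<^sub>1" and "N > 0"
    and l: "l = 1 - 2 * (real N - 1)^2 * concentration \<rho>\<^sub>1 \<beta>" "l > 0"
    and P0: "P\<^sub>0 \<in> transport_plans N \<rho>\<^sub>0" and P1: "P\<^sub>1 \<in> transport_plans N \<rho>\<^sub>1"
    and h: "h \<in> borel_measurable borel" "\<And>x. h x \<le> (1 :: ennreal)" and "m \<ge> 0"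
    and h_le: "\<And>B. B \<in> sets borel \<Longrightarrow> (\<integral>\<^sup>+x. h x * indicator B x \<partial>\<rho>\<^sub>0) \<le> emeasure \<rho>\<^sub>1 B"
    and h_compl: "(\<integral>\<^sup>+x. 1 - h x \<partial>\<rho>\<^sub>0) = ennreal m"
    and \<psi>: "\<psi> \<in> borel_measurable borel" and A: "\<And>t. \<beta> \<le> t \<Longrightarrow> \<psi> t \<le> A"
  shows "\<exists>T\<in>transport_plans N \<rho>\<^sub>1. (\<integral>\<^sup>+x. pairsum \<psi> N x \<partial>T)
    \<le> ennreal (1 - l / N) * (\<integral>\<^sup>+x. pairsum \<psi> N x \<partial>P\<^sub>1)
      + ennreal (l / N) * ((\<integral>\<^sup>+x. pairsum \<psi> N x \<partial>P\<^sub>0) + of_nat N ^ 4 * A * ennreal m)"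
proof -
  interpret \<rho>1: prob_space \<rho>\<^sub>1 using \<rho> by (simp add: borel_prob_def)
  interpret P0: prob_space P\<^sub>0 using P0 by (simp add: transport_plans_def)
  have s0: "sets P\<^sub>0 = sets (config N)" using P0 by (simp add: transport_plans_def)
  note mP0 = measurable_cong_sets[OF s0 refl]
  have s\<rho>1: "sets \<rho>\<^sub>1 = sets borel" using \<rho> by (simp add: borel_prob_def)
  note ps = pairsum_measurable[OF \<psi>, of N]
  \<comment> \<open>The subtraction is truncated at 0. The weight lies below every
    \<open>h (x i)\<close>, so each marginal of the thinned plan is below the common part, while
    \<open>1 - w\<close> is at most the sum of the \<open>N\<close> defects
    \<open>1 - h (x i)\<close>, each of integral \<open>m\<close>.\<close>
  define w where "w x = 1 - (\<Sum>i<N. 1 - h (x i))" for x :: "nat \<Rightarrow> R3"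
  have hi: "(\<lambda>x. 1 - h (x i)) \<in> borel_measurable (config N)" if "i < N" for i
    using coord_measurable[OF h(1) that] by measurable
  have w[measurable]: "w \<in> borel_measurable P\<^sub>0"
    unfolding w_def[abs_def] mP0 by (rule borel_measurable_minus_ennreal) (use hi in \<open>auto intro!: borel_measurable_sum\<close>)
  have w1: "w x \<le> 1" for x by (simp add: w_def diff_le_self_ennreal)
  have w_le: "w x \<le> h (x i)" if "i < N" for x i
  proof -
    have "w x \<le> 1 - (1 - h (x i))"
      unfolding w_def using that
      by (intro ennreal_minus_mono order_refl member_le_sum[of i "{..<N}" "\<lambda>i. 1 - h (x i)"]) auto
    also have "\<dots> = h (x i)" using h(2) by (simp add: diff_diff_ennreal)
    finally show ?thesis .
  qed
  define q where "q = (\<integral>\<^sup>+x. w x \<partial>P\<^sub>0)"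
  have q_le: "q \<le> 1"
    unfolding q_def using nn_integral_mono[of P\<^sub>0 w "\<lambda>_. 1"] w1 by (simp add: P0.emeasure_space_1)
  have "1 - q = (\<integral>\<^sup>+x. 1 \<partial>P\<^sub>0) - q" by (simp add: P0.emeasure_space_1)
  also have "\<dots> = (\<integral>\<^sup>+x. 1 - w x \<partial>P\<^sub>0)"
    unfolding q_def using q_le w1
    by (intro nn_integral_diff[symmetric]) (auto simp: q_def[symmetric] top_unique)
  also have "\<dots> \<le> (\<integral>\<^sup>+x. (\<Sum>i<N. 1 - h (x i)) \<partial>P\<^sub>0)"
    by (intro nn_integral_mono) (auto simp: w_def ennreal_minus_le_iff diff_add_self_ennreal)
  also have "\<dots> = (\<Sum>i<N. \<integral>\<^sup>+x. 1 - h (x i) \<partial>P\<^sub>0)"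
    using hi by (intro nn_integral_sum) (auto simp: mP0)
  also have "\<dots> = (\<Sum>i<N. ennreal m)"
    using h(1) by (intro sum.cong refl, subst transport_plans_marginal[OF P0]) (auto simp: h_compl)
  finally have q_ge: "1 - q \<le> of_nat N * ennreal m" by simp
  let ?Q = "density P\<^sub>0 w"
  have sQ: "sets ?Q = sets (config N)" by (simp add: s0)
  have Qi: "(\<integral>\<^sup>+x. f x \<partial>?Q) = (\<integral>\<^sup>+x. w x * f x \<partial>P\<^sub>0)" if "f \<in> borel_measurable (config N)" for f
    using that by (intro nn_integral_density w) (simp add: mP0)
  have "\<exists>D. sets D = sets borel \<and> (\<forall>f\<in>borel_measurable borel.
      (\<integral>\<^sup>+x. f x \<partial>\<rho>\<^sub>1) = (\<integral>\<^sup>+x. f x \<partial>D) + (\<integral>\<^sup>+x. f (x i) \<partial>?Q))" if i: "i < N" for i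
  proof -
    have c: "(\<lambda>x. x i) \<in> measurable ?Q borel"
      using coord_measurable[of "\<lambda>x. x" borel i N] i by (simp add: mP0)
    have le: "emeasure (distr ?Q borel (\<lambda>x. x i)) B \<le> emeasure \<rho>\<^sub>1 B" if B: "B \<in> sets borel" for B
    proof -
      have iB: "(\<lambda>x. indicator B (x i) :: ennreal) \<in> borel_measurable (config N)"
        using B by (intro coord_measurable[OF _ i]) auto
      have "emeasure (distr ?Q borel (\<lambda>x. x i)) B = (\<integral>\<^sup>+x. indicator B x \<partial>distr ?Q borel (\<lambda>x. x i))"
        using B by simp
      also have "\<dots> = (\<integral>\<^sup>+x. w x * indicator B (x i) \<partial>P\<^sub>0)"
        using B c by (subst nn_integral_distr) (auto simp: Qi[OF iB])
      also have "\<dots> \<le> (\<integral>\<^sup>+x. h (x i) * indicator B (x i) \<partial>P\<^sub>0)"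
        by (intro nn_integral_mono mult_right_mono w_le i) auto
      also have "\<dots> = (\<integral>\<^sup>+x. h x * indicator B x \<partial>\<rho>\<^sub>0)"
        using h(1) B by (intro transport_plans_marginal[OF P0 _ i]) auto
      also have "\<dots> \<le> emeasure \<rho>\<^sub>1 B" by (rule h_le[OF B])
      finally show ?thesis .
    qed
    obtain D where D: "sets D = sets borel"
      "\<And>f. f \<in> borel_measurable borel \<Longrightarrow>
        (\<integral>\<^sup>+x. f x \<partial>\<rho>\<^sub>1) = (\<integral>\<^sup>+x. f x \<partial>D) + (\<integral>\<^sup>+x. f x \<partial>distr ?Q borel (\<lambda>x. x i))"
      by (rule ex_measure_diff[OF \<rho>1.finite_measure_axioms s\<rho>1 sets_distr le]) blast+
    then show ?thesis
      using c by (intro exI[of _ D]) (auto simp: nn_integral_distr)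
  qed
  then obtain r where r: "\<And>i. i < N \<Longrightarrow> sets (r i) = sets borel"
    and r_int: "\<And>i f. i < N \<Longrightarrow> f \<in> borel_measurable borel \<Longrightarrow>
      (\<integral>\<^sup>+x. f x \<partial>\<rho>\<^sub>1) = (\<integral>\<^sup>+x. f x \<partial>r i) + (\<integral>\<^sup>+x. f (x i) \<partial>?Q)"
    by metis
  have Q_space: "(\<integral>\<^sup>+x. 1 \<partial>?Q) = q" using Qi[of "\<lambda>_. 1"] by (simp add: q_def)
  \<comment> \<open>All residual marginals have the same mass, as a coupling requires.\<close>
  have r_space: "emeasure (r i) (space (r i)) = ennreal (1 - enn2real q)" if "i < N" for i
  proof -
    have "1 = emeasure (r i) (space (r i)) + q"
      using r_int[OF that, of "\<lambda>_. 1"] Q_space by (simp add: \<rho>1.emeasure_space_1)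
    then have "emeasure (r i) (space (r i)) = 1 - q"
      using q_le by (metis ennreal_add_diff_cancel_right neq_top_trans ennreal_one_neq_top)
    then show ?thesis
      using q_le by (cases q) (auto simp: ennreal_minus top_unique simp flip: ennreal_1)
  qed
  have q1: "enn2real q \<le> 1" using q_le by (cases q) (auto simp: top_unique)
  obtain R where R: "sets R = sets (config N)"
    and R_int: "\<And>f i. f \<in> borel_measurable borel \<Longrightarrow> i < N \<Longrightarrow> (\<integral>\<^sup>+x. f (x i) \<partial>R) = (\<integral>\<^sup>+x. f x \<partial>r i)"
    by (rule ex_coupling[OF r r_space]) (use q1 in auto)
  have "emeasure R (space R) = emeasure (r 0) (space (r 0))"
    using R_int[of "\<lambda>_. 1" 0] \<open>N > 0\<close> by simp
  also have "\<dots> = 1 - q"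
    using r_space[of 0] \<open>N > 0\<close> q_le
    by (cases q) (auto simp: ennreal_minus top_unique simp flip: ennreal_1)
  also note q_ge
  finally have R_le: "emeasure R (space R) \<le> of_nat N * ennreal m" .
  obtain T where T: "T \<in> transport_plans N \<rho>\<^sub>1"
    and T_le: "\<And>\<psi> A. \<psi> \<in> borel_measurable borel \<Longrightarrow> (\<And>t. \<beta> \<le> t \<Longrightarrow> \<psi> t \<le> A) \<Longrightarrow>
      (\<integral>\<^sup>+x. pairsum \<psi> N x \<partial>T) \<le> ennreal (1 - l / N) * (\<integral>\<^sup>+x. pairsum \<psi> N x \<partial>P\<^sub>1)
        + ennreal (l / N) * ((\<integral>\<^sup>+x. pairsum \<psi> N x \<partial>?Q) + of_nat N ^ 3 * A * emeasure R (space R))"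
  proof (rule ex_improved_plan[OF \<rho>(2) \<open>N > 0\<close> l P1 sQ R])
    fix f :: "R3 \<Rightarrow> ennreal" and i assume "f \<in> borel_measurable borel" "i < N"
    then show "(\<integral>\<^sup>+x. f (x i) \<partial>?Q) + (\<integral>\<^sup>+x. f (x i) \<partial>R) = (\<integral>\<^sup>+x. f x \<partial>\<rho>\<^sub>1)"
      using r_int[of i f] R_int[of f i] by (simp add: add.commute)
  qed blast
  have "(\<integral>\<^sup>+x. pairsum \<psi> N x \<partial>?Q) \<le> (\<integral>\<^sup>+x. 1 * pairsum \<psi> N x \<partial>P\<^sub>0)"
    unfolding Qi[OF ps] by (intro nn_integral_mono mult_right_mono w1) auto
  moreover have "of_nat N ^ 3 * A * emeasure R (space R) \<le> of_nat N ^ 3 * A * (of_nat N * ennreal m)"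
    by (intro mult_left_mono R_le) auto
  moreover have "of_nat N ^ 3 * A * (of_nat N * ennreal m) = of_nat N ^ 4 * A * ennreal m"
    by (simp add: eval_nat_numeral ac_simps)
  ultimately have "(\<integral>\<^sup>+x. pairsum \<psi> N x \<partial>?Q) + of_nat N ^ 3 * A * emeasure R (space R)
      \<le> (\<integral>\<^sup>+x. pairsum \<psi> N x \<partial>P\<^sub>0) + of_nat N ^ 4 * A * ennreal m"
    by (intro add_mono) auto
  then have "(\<integral>\<^sup>+x. pairsum \<psi> N x \<partial>T) \<le> ennreal (1 - l / N) * (\<integral>\<^sup>+x. pairsum \<psi> N x \<partial>P\<^sub>1)
      + ennreal (l / N) * ((\<integral>\<^sup>+x. pairsum \<psi> N x \<partial>P\<^sub>0) + of_nat N ^ 4 * A * ennreal m)"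
    by (intro order_trans[OF T_le[OF \<psi> A] add_left_mono[OF mult_left_mono]]) auto
  with T show ?thesis by blast
qed

section \<open>Optimal values and the final estimate\<close>

definition opt_pairsum :: "(real \<Rightarrow> ennreal) \<Rightarrow> nat \<Rightarrow> R3 measure \<Rightarrow> ennreal" where
  "opt_pairsum \<psi> N \<rho> = (INF P\<in>transport_plans N \<rho>. \<integral>\<^sup>+x. pairsum \<psi> N x \<partial>P)"

text \<open>The compared plan is admissible for \<open>\<rho>\<^sub>1\<close>, so nearly optimal
  plans give \<open>c1 \<le> (1 - e) * c1 + e * (c0 + K)\<close> up to a small error. As
  \<open>c1\<close> is finite, \<open>(1 - e) * c1\<close> can be subtracted and \<open>e\<close>
  divided out.\<close>

lemma opt_pairsum_le_add:
  assumes \<rho>: "borel_prob \<rho>\<^sub>0" "borel_prob \<rho>\<^sub>1" and "N > 0"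
    and l: "l = 1 - 2 * (real N - 1)^2 * concentration \<rho>\<^sub>1 \<beta>" "l > 0"
    and \<psi>: "\<psi> \<in> borel_measurable borel" and A: "\<And>t. \<beta> \<le> t \<Longrightarrow> \<psi> t \<le> ennreal A" "A \<ge> 0"
    and fin: "opt_pairsum \<psi> N \<rho>\<^sub>0 < \<infinity>" "opt_pairsum \<psi> N \<rho>\<^sub>1 < \<infinity>"
  shows "\<exists>m\<ge>0. ennreal (2 * m) \<le> L1_dist \<rho>\<^sub>0 \<rho>\<^sub>1 \<and>
    enn2real (opt_pairsum \<psi> N \<rho>\<^sub>1) \<le> enn2real (opt_pairsum \<psi> N \<rho>\<^sub>0) + real N ^ 4 * A * m"
proof -
  obtain h m where h: "h \<in> borel_measurable borel" "\<And>x. h x \<le> (1 :: ennreal)" and m: "m \<ge> 0"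
    and h_le: "\<And>B. B \<in> sets borel \<Longrightarrow> (\<integral>\<^sup>+x. h x * indicator B x \<partial>\<rho>\<^sub>0) \<le> emeasure \<rho>\<^sub>1 B"
    and h_compl: "(\<integral>\<^sup>+x. 1 - h x \<partial>\<rho>\<^sub>0) = ennreal m"
    and L1: "ennreal (2 * m) \<le> L1_dist \<rho>\<^sub>0 \<rho>\<^sub>1"
    using ex_common_density[OF \<rho>] by blast
  define c0 c1 where "c0 = enn2real (opt_pairsum \<psi> N \<rho>\<^sub>0)" and "c1 = enn2real (opt_pairsum \<psi> N \<rho>\<^sub>1)"
  have c: "opt_pairsum \<psi> N \<rho>\<^sub>0 = ennreal c0" "opt_pairsum \<psi> N \<rho>\<^sub>1 = ennreal c1" "c0 \<ge> 0" "c1 \<ge> 0"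
    using fin by (auto simp: c0_def c1_def)
  define e where "e = l / N"
  have l1: "l \<le> 1" using concentration_nonneg[OF \<rho>(2), of \<beta>] l by simp
  then have "l \<le> real N" using \<open>N > 0\<close> by linarith
  then have e: "0 < e" "e \<le> 1" using l(2) \<open>N > 0\<close> by (auto simp: e_def)
  define K where "K = real N ^ 4 * A * m"
  have K: "K \<ge> 0" using A(2) m by (simp add: K_def)
  have "c1 \<le> (c0 + K) + \<eta>" if "\<eta> > 0" for \<eta>
  proof -
    \<comment> \<open>Both plans are optimal up to \<open>d\<close>; the total error
      \<open>(1 - e) * d + e * d = d\<close> becomes \<open>\<eta>\<close> after division by
      \<open>e\<close>.\<close>
    define d where "d = e * \<eta>"
    have d: "d > 0" using e that by (simp add: d_def)
    obtain P0 where P0: "P0 \<in> transport_plans N \<rho>\<^sub>0" "(\<integral>\<^sup>+x. pairsum \<psi> N x \<partial>P0) < ennreal (c0 + d)"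
      using c d INF_less_iff[of "\<lambda>P. \<integral>\<^sup>+x. pairsum \<psi> N x \<partial>P" "transport_plans N \<rho>\<^sub>0" "ennreal (c0 + d)"]
      by (auto simp: opt_pairsum_def ennreal_less_iff)
    obtain P1 where P1: "P1 \<in> transport_plans N \<rho>\<^sub>1" "(\<integral>\<^sup>+x. pairsum \<psi> N x \<partial>P1) < ennreal (c1 + d)"
      using c d INF_less_iff[of "\<lambda>P. \<integral>\<^sup>+x. pairsum \<psi> N x \<partial>P" "transport_plans N \<rho>\<^sub>1" "ennreal (c1 + d)"]
      by (auto simp: opt_pairsum_def ennreal_less_iff)
    obtain T where T: "T \<in> transport_plans N \<rho>\<^sub>1" and T_le: "(\<integral>\<^sup>+x. pairsum \<psi> N x \<partial>T)
        \<le> ennreal (1 - e) * (\<integral>\<^sup>+x. pairsum \<psi> N x \<partial>P1)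
          + ennreal e * ((\<integral>\<^sup>+x. pairsum \<psi> N x \<partial>P0) + of_nat N ^ 4 * ennreal A * ennreal m)"
      using plan_comparison[OF \<rho> \<open>N > 0\<close> l P0(1) P1(1) h m h_le h_compl \<psi> A(1)]
      unfolding e_def by blast
    have "ennreal c1 \<le> (\<integral>\<^sup>+x. pairsum \<psi> N x \<partial>T)"
      unfolding c(2)[symmetric] opt_pairsum_def by (rule INF_lower[OF T])
    also note T_le
    also have "of_nat N ^ 4 * ennreal A * ennreal m = ennreal K"
      using A(2) m by (simp add: K_def ennreal_mult ennreal_of_nat_eq_real_of_nat ennreal_power)
    also have "ennreal (1 - e) * (\<integral>\<^sup>+x. pairsum \<psi> N x \<partial>P1)
          + ennreal e * ((\<integral>\<^sup>+x. pairsum \<psi> N x \<partial>P0) + ennreal K)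
        \<le> ennreal (1 - e) * ennreal (c1 + d) + ennreal e * (ennreal (c0 + d) + ennreal K)"
      using P0(2) P1(2) by (intro add_mono mult_left_mono) auto
    also have "\<dots> = ennreal ((1 - e) * (c1 + d) + e * ((c0 + d) + K))"
      using c d K e by (simp add: ennreal_mult)
    finally have "c1 \<le> (1 - e) * (c1 + d) + e * ((c0 + d) + K)"
      using c d K e by (subst (asm) ennreal_le_iff) auto
    then have "e * c1 \<le> e * (c0 + K + \<eta>)" by (simp add: d_def algebra_simps)
    then show ?thesis using e by simp
  qed
  then have "c1 \<le> c0 + K" by (rule field_le_epsilon)
  then show ?thesis using m L1 by (intro exI[of _ m]) (simp add: c0_def c1_def K_def)
qed

lemma L1_dist_commute: "L1_dist \<rho>\<^sub>1 \<rho>\<^sub>2 = L1_dist \<rho>\<^sub>2 \<rho>\<^sub>1"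
  by (simp add: L1_dist_def total_variation_def abs_minus_commute)

lemma opt_pairsum_finite:
  assumes "borel_prob \<rho>" "N > 0"
    and "l = 1 - 2 * (real N - 1)^2 * concentration \<rho> \<beta>" "l > 0"
    and "\<psi> \<in> borel_measurable borel" "\<And>t. \<beta> \<le> t \<Longrightarrow> \<psi> t \<le> ennreal A"
  shows "opt_pairsum \<psi> N \<rho> < \<infinity>"
  using ex_finite_cost_plan[OF assms] unfolding opt_pairsum_def INF_less_iff by blast

text \<open>Under the concentration hypothesis the subtracted term is below \<open>2 / N\<close>,
  which is at most 1 as \<open>N \<ge> 2\<close>.\<close>

lemma concentration_slack:
  assumes "N > 1" "\<kappa> < 1 / (real N * (real N - 1)^2)"
  shows "1 - 2 * (real N - 1)^2 * \<kappa> > 0"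
proof -
  have "2 * (real N - 1)^2 * \<kappa> < 2 * (real N - 1)^2 * (1 / (real N * (real N - 1)^2))"
    using assms by (intro mult_strict_left_mono) auto
  also have "\<dots> = 2 / real N" using assms(1) by (simp add: field_simps)
  also have "\<dots> \<le> 1" using assms(1) by (simp add: field_simps)
  finally show ?thesis by simp
qed

text \<open>Intermediate values between \<open>\<beta>\<close> and a point near 0 where
  \<open>\<phi>\<close> exceeds \<open>c\<close>. It ensures that the inverse in the condition on
  \<open>\<alpha>\<close> is taken at a value attained by \<open>\<phi>\<close>.\<close>

lemma ex_preimage_above:
  fixes \<phi> :: "real \<Rightarrow> real"
  assumes cont: "continuous_on {0<..} \<phi>" and lim: "filterlim \<phi> at_top (at_right 0)"
    and "\<beta> > 0" "\<phi> \<beta> \<le> c"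
  shows "\<exists>t>0. \<phi> t = c"
proof -
  have "eventually (\<lambda>t. c \<le> \<phi> t) (at_right 0)"
    using lim by (simp add: filterlim_at_top)
  moreover have "eventually (\<lambda>t. t \<in> {0<..<\<beta>}) (at_right 0)"
    using \<open>\<beta> > 0\<close> by (rule eventually_at_right_real)
  ultimately have "eventually (\<lambda>t. c \<le> \<phi> t \<and> t \<in> {0<..<\<beta>}) (at_right 0)"
    by (rule eventually_conj)
  then obtain s where s: "c \<le> \<phi> s" "0 < s" "s < \<beta>"
    using eventually_happens[of _ "at_right (0::real)"] by auto
  have "continuous_on {s..\<beta>} \<phi>" using s by (intro continuous_on_subset[OF cont]) auto
  then obtain t where "s \<le> t" "t \<le> \<beta>" "\<phi> t = c"
    using IVT2'[of \<phi> \<beta> c s] s assms(4) by auto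
  then show ?thesis using s by (intro exI[of _ t]) auto
qed

text \<open>Finiteness of both values is part of the conclusion: \<open>enn2real\<close> sends
  infinity to 0, so the estimate on real parts alone would not say enough.\<close>

theorem theorem3p11:
  fixes N :: nat and \<phi> :: "real \<Rightarrow> real" and \<rho>\<^sub>1 \<rho>\<^sub>2 :: "R3 measure" and \<alpha> \<beta> :: real
  assumes "N > 1"
    and "continuous_on {0<..} \<phi>"
    and "\<And>t. t > 0 \<Longrightarrow> \<phi> t \<ge> 0"
    and "strict_antimono_on {0<..} \<phi>"
    and "filterlim \<phi> at_top (at_right 0)"
    and "borel_prob \<rho>\<^sub>1" and "borel_prob \<rho>\<^sub>2"
    and "\<beta> > 0"
    and "concentration \<rho>\<^sub>1 \<beta> < 1 / (real N * (real N - 1)^2)"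
    and "concentration \<rho>\<^sub>2 \<beta> < 1 / (real N * (real N - 1)^2)"
    and "\<alpha> > 0"
    and "\<alpha> < the_inv_into {0<..} \<phi> (real N ^ 2 * (real N - 1) / 2 * \<phi> \<beta>)"
  shows "opt_cost \<phi> N \<rho>\<^sub>1 < \<infinity> \<and> opt_cost \<phi> N \<rho>\<^sub>2 < \<infinity> \<and>
    ennreal \<bar>enn2real (opt_cost \<phi> N \<rho>\<^sub>1) - enn2real (opt_cost \<phi> N \<rho>\<^sub>2)\<bar>
      \<le> ennreal (real N ^ 2 * (real N - 1)^2 * \<phi> (\<alpha> / 2)) * L1_dist \<rho>\<^sub>1 \<rho>\<^sub>2"
proof -
  have N: "real N \<ge> 2" using assms(1) by simp
  have N0: "N > 0" using assms(1) by simp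
  have anti: "\<phi> t < \<phi> s" if "0 < s" "s < t" for s t
    using assms(4) that by (auto simp: monotone_on_def)
  define c where "c = real N ^ 2 * (real N - 1) / 2 * \<phi> \<beta>"
  have \<phi>\<beta>: "\<phi> \<beta> \<ge> 0" using assms(3,8) by simp
  \<comment> \<open>The factor in front of \<open>\<phi> \<beta>\<close> is at least 1, so
    \<open>c\<close> is not below \<open>\<phi> \<beta>\<close> and has a preimage.\<close>
  have "2 * 1 \<le> real N ^ 2 / 2 * (real N - 1)"
    using N power_mono[of 2 "real N" 2] by (intro mult_mono) auto
  then have "\<phi> \<beta> \<le> c"
    unfolding c_def using \<phi>\<beta> mult_right_mono[of 1 "real N ^ 2 * (real N - 1) / 2" "\<phi> \<beta>"] by simp
  then obtain t where t: "t > 0" "\<phi> t = c"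
    using ex_preimage_above[OF assms(2,5,8)] by blast
  have "inj_on \<phi> {0<..}"
    by (rule inj_onI) (metis anti greaterThan_iff less_irrefl linorder_neqE_linordered_idom)
  then have "the_inv_into {0<..} \<phi> c = t" using t by (auto intro!: the_inv_into_f_eq)
  then have \<alpha>t: "\<alpha> < t" using assms(12) by (simp add: c_def)
  have c_le: "c \<le> \<phi> (\<alpha> / 2)" using anti[of "\<alpha> / 2" t] t \<alpha>t assms(11) by simp
  \<comment> \<open>It agrees with \<open>phi_ext \<phi>\<close> for \<open>t \<ge> 0\<close>.
    Nothing is known about \<open>\<phi>\<close> on negative numbers, and the value there is set so
    that \<open>\<psi>\<close> is Borel measurable on the whole line.\<close>
  define \<psi> where "\<psi> t = (if t \<le> 0 then \<infinity> else ennreal (\<phi> t))" for t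
  have "(\<lambda>t. indicator {0<..} t * \<phi> t) \<in> borel_measurable borel"
    using borel_measurable_continuous_on_indicator[OF _ assms(2)] by simp
  then have "(\<lambda>t. if t \<le> 0 then \<infinity> else ennreal (indicator {0<..} t * \<phi> t)) \<in> borel_measurable borel"
    by measurable
  also have "(\<lambda>t. if t \<le> 0 then \<infinity> else ennreal (indicator {0<..} t * \<phi> t)) = \<psi>"
    by (auto simp: \<psi>_def fun_eq_iff)
  finally have \<psi>: "\<psi> \<in> borel_measurable borel" .
  have A: "\<psi> t \<le> ennreal (\<phi> \<beta>)" if "\<beta> \<le> t" for t
    using that anti[of \<beta> t] assms(8) by (cases "t = \<beta>") (auto simp: \<psi>_def intro!: ennreal_leI)
  have "cost \<phi> N x = pairsum \<psi> N x" for x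
    unfolding cost_def pairsum_def
    by (intro sum.cong refl) (auto simp: phi_ext_def \<psi>_def)
  then have opt: "opt_cost \<phi> N \<rho> = opt_pairsum \<psi> N \<rho>" for \<rho>
    by (simp add: opt_cost_def opt_pairsum_def)
  note slack = concentration_slack[OF assms(1,9)] concentration_slack[OF assms(1,10)]
  have fin: "opt_pairsum \<psi> N \<rho>\<^sub>1 < \<infinity>" "opt_pairsum \<psi> N \<rho>\<^sub>2 < \<infinity>"
    using opt_pairsum_finite[OF assms(6) N0 refl slack(1) \<psi> A]
      opt_pairsum_finite[OF assms(7) N0 refl slack(2) \<psi> A] by auto
  obtain m1 where m1: "m1 \<ge> 0" "ennreal (2 * m1) \<le> L1_dist \<rho>\<^sub>1 \<rho>\<^sub>2"
    "enn2real (opt_pairsum \<psi> N \<rho>\<^sub>2) \<le> enn2real (opt_pairsum \<psi> N \<rho>\<^sub>1) + real N ^ 4 * \<phi> \<beta> * m1"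
    using opt_pairsum_le_add[OF assms(6,7) N0 refl slack(2) \<psi> A \<phi>\<beta> fin] by blast
  obtain m2 where m2: "m2 \<ge> 0" "ennreal (2 * m2) \<le> L1_dist \<rho>\<^sub>1 \<rho>\<^sub>2"
    "enn2real (opt_pairsum \<psi> N \<rho>\<^sub>1) \<le> enn2real (opt_pairsum \<psi> N \<rho>\<^sub>2) + real N ^ 4 * \<phi> \<beta> * m2"
    using opt_pairsum_le_add[OF assms(7,6) N0 refl slack(1) \<psi> A \<phi>\<beta> fin(2,1)]
    unfolding L1_dist_commute[of \<rho>\<^sub>2 \<rho>\<^sub>1] by blast
  \<comment> \<open>Each direction of the estimate brings its own \<open>m\<close>; the larger one
    still satisfies the bound by the distance.\<close>
  define m where "m = max m1 m2"
  have m: "m \<ge> 0" "ennreal (2 * m) \<le> L1_dist \<rho>\<^sub>1 \<rho>\<^sub>2"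
    using m1 m2 by (auto simp: m_def max_def)
  have c4: "real N ^ 4 * \<phi> \<beta> * mi \<le> real N ^ 4 * \<phi> \<beta> * m" if "mi \<le> m" for mi
    using that \<phi>\<beta> by (intro mult_left_mono) auto
  define K where "K = real N ^ 2 * (real N - 1)^2 * \<phi> (\<alpha> / 2)"
  have K: "K \<ge> 0" using assms(3)[of "\<alpha> / 2"] assms(11) by (simp add: K_def)
  \<comment> \<open>Inserting \<open>(N - 1) ^ 3 \<ge> 1\<close> produces exactly twice
    \<open>N ^ 2 * (N - 1) ^ 2 * c\<close>, and \<open>c \<le> \<phi> (\<alpha> / 2)\<close>. The
    factor 2 is absorbed by \<open>2 * m\<close>, which is bounded by the distance.\<close>
  have "real N ^ 4 * \<phi> \<beta> * 1 \<le> real N ^ 4 * \<phi> \<beta> * (real N - 1) ^ 3"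
    using N \<phi>\<beta> by (intro mult_left_mono one_le_power) auto
  also have "\<dots> = 2 * (real N ^ 2 * (real N - 1)^2 * c)"
    by (simp add: c_def eval_nat_numeral)
  also have "\<dots> \<le> 2 * K"
    unfolding K_def by (intro mult_left_mono c_le) auto
  finally have "real N ^ 4 * \<phi> \<beta> * m \<le> 2 * K * m"
    using m(1) by (intro mult_right_mono) auto
  then have "\<bar>enn2real (opt_pairsum \<psi> N \<rho>\<^sub>1) - enn2real (opt_pairsum \<psi> N \<rho>\<^sub>2)\<bar> \<le> K * (2 * m)"
    using m1(3) m2(3) c4[of m1] c4[of m2] by (auto simp: m_def)
  then have "ennreal \<bar>enn2real (opt_pairsum \<psi> N \<rho>\<^sub>1) - enn2real (opt_pairsum \<psi> N \<rho>\<^sub>2)\<bar>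
      \<le> ennreal K * ennreal (2 * m)"
    using K m(1) by (subst ennreal_mult[symmetric]) (auto intro!: ennreal_leI)
  also have "\<dots> \<le> ennreal K * L1_dist \<rho>\<^sub>1 \<rho>\<^sub>2" by (intro mult_left_mono m) auto
  finally show ?thesis using fin by (simp add: opt K_def)
qed

end
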